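(* Suppose the MDP is uniformly ergodic (as defined in the context), so that $t_{\mathrm{minorize}}<\infty$, and that $t_{\mathrm{minorize}}$ is known. Fix an error tolerance $\epsilon\in(0,1]$ and a failure probability $\delta\in(0,1)$. Run the algorithm PMBP$(\gamma,\zeta,n)$ with \[ \gamma = 1-\frac{\epsilon}{19\,t_{\mathrm{minorize}}},\qquad \zeta=\frac14(1-\gamma)t_{\mathrm{minorize}},\qquad n=\frac{c\,\beta_\delta(\eta^*_\delta)}{(1-\gamma)^2 t_{\mathrm{minorize}}},\quad c=4\cdot 486^2, \] and let $\hat\pi_0$ be its output. Then with probability at least $1-\delta$, \[ 0\le \bar\alpha-\alpha^{\hat\pi_0}\le \epsilon , \] and the total number of samples used, $|S||A|n$, is $\widetilde O\big(|S||A|\,t_{\mathrm{minorize}}\,\epsilon^{-2}\big)$ (where $\widetilde O$ hides factors logarithmic in $|S|,|A|,t_{\mathrm{minorize}},\epsilon^{-1},\delta^{-1}$).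
   Context: $S,A$ are finite state and action sets. An MDP is given by a reward $r:S\times A\to[0,1]$ and a transition kernel $P=\{p_{s,a}\in\mathcal P(S)\}$; for a probability vector $p$ and $v\in\mathbb R^{S}$, $p[v]=\sum_s p(s)v(s)$. $\Pi$ is the (finite) set of deterministic stationary Markov policies $\pi:S\to A$; $P_\pi(s,s')=p_{s,\pi(s)}(s')$, $r_\pi(s)=r(s,\pi(s))$. Uniform ergodicity: for every $\pi\in\Pi$ there exist an integer $m\ge1$, $q\in(0,1]$ and $\psi\in\mathcal P(S)$ with $P_\pi^m(s,\cdot)\ge q\psi(\cdot)$ for all $s\in S$. For such $\pi$, $t_{\mathrm{minorize}}(P_\pi)=\inf\{m/q:\ P_\pi^m(s,\cdot)\ge q\psi(\cdot)\ \forall s \text{ for some }\psi\in\mathcal P(S)\}$, and $t_{\mathrm{minorize}}=\max_{\pi\in\Pi}t_{\mathrm{minorize}}(P_\pi)$. The long-run average reward of $\pi$ is $\alpha^\pi=\lim_{T\to\infty}\frac1T E^\pi_\mu[\sum_{t=0}^{T-1}r(X_t,A_t)]$ (the limit exists and does not depend on the initial distribution $\mu$ under uniform ergodicity), and $\bar\alpha=\max_{\pi\in\Pi}\alpha^\pi$. Generative model: for any $(s,a)$ one can draw independent samples from $p_{s,a}$. Algorithm PMBP$(\gamma,\zeta,n)$ (perturbed model-based planning): draw $Z(s,a)\sim\mathrm{Unif}(0,\zeta)$ i.i.d. over $(s,a)\in S\times A$ and set $R=r+Z$; independently, for each $(s,a)$ draw $n$ i.i.d. samples $S^{(1)}_{s,a},\dots,S^{(n)}_{s,a}\sim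 p_{s,a}$ and form $\hat p_{s,a}(s')=\frac1n\sum_{i=1}^n\mathbf 1\{S^{(i)}_{s,a}=s'\}$; compute the unique $\hat v_0\in\mathbb R^S$ with $\hat v_0(s)=\max_{a}\{R(s,a)+\gamma\hat p_{s,a}[\hat v_0]\}$ for all $s$, and return a greedy policy $\hat\pi_0(s)\in\arg\max_a\{R(s,a)+\gamma\hat p_{s,a}[\hat v_0]\}$. Parameters: $\beta_\delta(\eta)=2\log\!\Big(\frac{24|S||A|\log_2((1-\gamma)^{-1})}{(1-\gamma)^2\eta\delta}\Big)$ and $\eta^*_\delta=\frac{\zeta\delta(1-\gamma)}{9|S||A|^2}$. *)

theory Defs
  imports "HOL-Probability.Probability"
begin

fun kpow :: "('s \<Rightarrow> 'a \<Rightarrow> 's pmf) \<Rightarrow> ('s \<Rightarrow> 'a) \<Rightarrow> nat \<Rightarrow> 's \<Rightarrow> 's pmf" where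
  "kpow p pol 0 s = return_pmf s"
| "kpow p pol (Suc m) s = bind_pmf (kpow p pol m s) (\<lambda>x. p x (pol x))"

definition minorizes :: "('s \<Rightarrow> 'a \<Rightarrow> 's pmf) \<Rightarrow> ('s \<Rightarrow> 'a) \<Rightarrow> nat \<Rightarrow> real \<Rightarrow> 's pmf \<Rightarrow> bool" where
  "minorizes p pol m q \<psi> \<longleftrightarrow> (\<forall>s s'. pmf (kpow p pol m s) s' \<ge> q * pmf \<psi> s')"

definition uniformly_ergodic :: "('s \<Rightarrow> 'a \<Rightarrow> 's pmf) \<Rightarrow> bool" where
  "uniformly_ergodic p \<longleftrightarrow>
     (\<forall>pol. \<exists>m q \<psi>. m \<ge> 1 \<and> 0 < q \<and> q \<le> 1 \<and> minorizes p pol m q \<psi>)"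

definition t_minorize_pol :: "('s \<Rightarrow> 'a \<Rightarrow> 's pmf) \<Rightarrow> ('s \<Rightarrow> 'a) \<Rightarrow> real" where
  "t_minorize_pol p pol =
     Inf {real m / q | m q. m \<ge> 1 \<and> 0 < q \<and> q \<le> 1 \<and> (\<exists>\<psi>. minorizes p pol m q \<psi>)}"

definition t_minorize :: "('s::finite \<Rightarrow> 'a::finite \<Rightarrow> 's pmf) \<Rightarrow> real" where
  "t_minorize p = Max (range (t_minorize_pol p))"

definition exp_reward ::
  "('s \<Rightarrow> 'a \<Rightarrow> 's pmf) \<Rightarrow> ('s \<Rightarrow> 'a \<Rightarrow> real) \<Rightarrow> ('s \<Rightarrow> 'a) \<Rightarrow> 's pmf \<Rightarrow> nat \<Rightarrow> real" where
  "exp_reward p r pol \<mu> t =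
     measure_pmf.expectation (bind_pmf \<mu> (\<lambda>s. kpow p pol t s)) (\<lambda>s. r s (pol s))"

definition avg_reward :: "('s \<Rightarrow> 'a \<Rightarrow> 's pmf) \<Rightarrow> ('s \<Rightarrow> 'a \<Rightarrow> real) \<Rightarrow> ('s \<Rightarrow> 'a) \<Rightarrow> real" where
  "avg_reward p r pol =
     (THE \<alpha>. \<forall>\<mu>. (\<lambda>T. (\<Sum>t<T. exp_reward p r pol \<mu> t) / real T) \<longlonglongrightarrow> \<alpha>)"

definition opt_avg_reward :: "('s::finite \<Rightarrow> 'a::finite \<Rightarrow> 's pmf) \<Rightarrow> ('s \<Rightarrow> 'a \<Rightarrow> real) \<Rightarrow> real" where
  "opt_avg_reward p r = Max (range (avg_reward p r))"

definition phat :: "nat \<Rightarrow> ('s \<times> 'a \<times> nat \<Rightarrow> 's) \<Rightarrow> 's \<Rightarrow> 'a \<Rightarrow> 's \<Rightarrow> real" where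
  "phat n X s a s' = real (card {i \<in> {..<n}. X (s, a, i) = s'}) / real n"

definition bellman :: "('s \<Rightarrow> 'a \<Rightarrow> real) \<Rightarrow> ('s \<Rightarrow> 'a \<Rightarrow> 's \<Rightarrow> real) \<Rightarrow> real
    \<Rightarrow> ('s::finite \<Rightarrow> real) \<Rightarrow> 's \<Rightarrow> 'a \<Rightarrow> real" where
  "bellman R ph \<gamma> v s a = R s a + \<gamma> * (\<Sum>s'\<in>UNIV. ph s a s' * v s')"

definition disc_value :: "('s::finite \<Rightarrow> 'a::finite \<Rightarrow> real) \<Rightarrow> ('s \<Rightarrow> 'a \<Rightarrow> 's \<Rightarrow> real) \<Rightarrow> real
    \<Rightarrow> 's \<Rightarrow> real" where
  "disc_value R ph \<gamma> = (THE v. \<forall>s. v s = Max (range (bellman R ph \<gamma> v s)))"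

definition greedy :: "('s::finite \<Rightarrow> 'a::finite \<Rightarrow> real) \<Rightarrow> ('s \<Rightarrow> 'a \<Rightarrow> 's \<Rightarrow> real) \<Rightarrow> real
    \<Rightarrow> ('s \<Rightarrow> 'a) \<Rightarrow> bool" where
  "greedy R ph \<gamma> pol \<longleftrightarrow>
     (\<forall>s a. bellman R ph \<gamma> (disc_value R ph \<gamma>) s a
              \<le> bellman R ph \<gamma> (disc_value R ph \<gamma>) s (pol s))"

definition pmbp_space :: "('s::finite \<Rightarrow> 'a::finite \<Rightarrow> 's pmf) \<Rightarrow> real \<Rightarrow> nat
    \<Rightarrow> (('s \<times> 'a \<Rightarrow> real) \<times> ('s \<times> 'a \<times> nat \<Rightarrow> 's)) measure" where
  "pmbp_space p \<zeta> n =
     (PiM UNIV (\<lambda>_. uniform_measure lborel {0<..<\<zeta>}))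
     \<Otimes>\<^sub>M measure_pmf (Pi_pmf {(s, a, i). i < n} undefined (\<lambda>(s, a, i). p s a))"

text \<open>Outputs of PMBP on the random input omega = (Z, X): a policy is a
  possible output iff it is greedy for the perturbed empirical model.\<close>
definition pmbp_output :: "('s::finite \<Rightarrow> 'a::finite \<Rightarrow> real) \<Rightarrow> real \<Rightarrow> nat
    \<Rightarrow> ('s \<times> 'a \<Rightarrow> real) \<times> ('s \<times> 'a \<times> nat \<Rightarrow> 's) \<Rightarrow> ('s \<Rightarrow> 'a) \<Rightarrow> bool" where
  "pmbp_output r \<gamma> n \<omega> pol \<longleftrightarrow>
     greedy (\<lambda>s a. r s a + fst \<omega> (s, a)) (phat n (snd \<omega>)) \<gamma> pol"

definition beta_delta :: "nat \<Rightarrow> nat \<Rightarrow> real \<Rightarrow> real \<Rightarrow> real \<Rightarrow> real" where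
  "beta_delta nS nA \<gamma> \<delta> \<eta> =
     2 * ln ((24 * real nS * real nA * log 2 (1 / (1 - \<gamma>))) / ((1 - \<gamma>)^2 * \<eta> * \<delta>))"

definition eta_star :: "nat \<Rightarrow> nat \<Rightarrow> real \<Rightarrow> real \<Rightarrow> real \<Rightarrow> real" where
  "eta_star nS nA \<gamma> \<zeta> \<delta> = \<zeta> * \<delta> * (1 - \<gamma>) / (9 * real nS * real nA ^ 2)"

end

theory Submission
  imports Defs
begin

text \<open>Write \<open>t\<close> for \<open>t_minorize p\<close>, \<open>H = 1 / (1 - \<gamma>)\<close>, and \<open>v\<close> for the optimal value of the
  perturbed empirical model. A discounted value of a policy in the true model has span at most
  \<open>t\<close> times the largest reward, and the average reward lies between the extremes of \<open>1 - \<gamma>\<close>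
  times the discounted value; so it suffices that the greedy policy is \<open>O(t)\<close>-optimal for the
  discounted criterion. Against either the greedy or an average-optimal policy, \<open>v\<close> misses the
  true value by at most the discounted sum, along the true chain, of the one-step errors
  \<open>\<bar>(P' - P) v\<bar>\<close>, where \<open>P'\<close> is the empirical kernel \<open>phat\<close>. A Bernstein bound
  \<open>k * Var(v) + l\<close> for these errors, with \<open>k\<close> of order \<open>1 / H\<close>, makes the sum \<open>O(t)\<close>,
  because the discounted sum of the variances is \<open>O(H)\<close> times the span of \<open>v\<close>, which in turn
  is \<open>O(t)\<close> up to the same error.

  The dependence of \<open>v\<close> on the samples of a state \<open>s\<close> is removed by making \<open>s\<close> absorbing with a
  prescribed value ranging over a finite net. The perturbation plays no role beyond the bias it
  causes: the argument covers every greedy policy, unique or not.\<close>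

section \<open>Expectations on a finite state space\<close>

definition pmean :: "'s::finite pmf \<Rightarrow> ('s \<Rightarrow> real) \<Rightarrow> real" where
  "pmean q f = (\<Sum>x\<in>UNIV. pmf q x * f x)"

definition pvar :: "'s::finite pmf \<Rightarrow> ('s \<Rightarrow> real) \<Rightarrow> real" where
  "pvar q f = pmean q (\<lambda>x. (f x - pmean q f)^2)"

lemma sum_pmf_UNIV: "(\<Sum>x\<in>UNIV. pmf (q::'s::finite pmf) x) = 1"
  by (rule sum_pmf_eq_1) auto

lemma expectation_eq_pmean: "measure_pmf.expectation q f = pmean q f"
  unfolding pmean_def by (subst integral_measure_pmf[of UNIV]) auto

lemma pmean_const [simp]: "pmean q (\<lambda>_. c) = c"
  by (simp add: pmean_def sum_distrib_right[symmetric] sum_pmf_UNIV)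

lemma pmean_add: "pmean q (\<lambda>x. f x + g x) = pmean q f + pmean q g"
  by (simp add: pmean_def algebra_simps sum.distrib)

lemma pmean_diff: "pmean q (\<lambda>x. f x - g x) = pmean q f - pmean q g"
  by (simp add: pmean_def algebra_simps sum_subtractf)

lemma pmean_cmult: "pmean q (\<lambda>x. c * f x) = c * pmean q f"
  by (simp add: pmean_def algebra_simps sum_distrib_left)

lemma pmean_uminus: "pmean q (\<lambda>x. - f x) = - pmean q f"
  by (simp add: pmean_def sum_negf)

lemma pmean_mono: "(\<And>x. f x \<le> g x) \<Longrightarrow> pmean q f \<le> pmean q g"
  unfolding pmean_def by (intro sum_mono mult_left_mono) auto

lemma pmean_le: "(\<And>x. f x \<le> c) \<Longrightarrow> pmean q f \<le> c"
  using pmean_mono[of f "\<lambda>_. c" q] by simp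

lemma pmean_ge: "(\<And>x. c \<le> f x) \<Longrightarrow> c \<le> pmean q f"
  using pmean_mono[of "\<lambda>_. c" f q] by simp

lemma pmean_abs_diff_le:
  assumes "\<And>x. \<bar>f x - g x\<bar> \<le> c" shows "\<bar>pmean q f - pmean q g\<bar> \<le> c"
proof -
  have "pmean q (\<lambda>x. f x - g x) \<le> c"
    by (rule pmean_le) (use assms in \<open>auto simp: abs_le_iff\<close>)
  moreover have "- c \<le> pmean q (\<lambda>x. f x - g x)"
    by (rule pmean_ge) (use assms in \<open>smt (verit)\<close>)
  ultimately show ?thesis by (simp add: pmean_diff)
qed

lemma pmean_bind: "pmean (bind_pmf q K) f = pmean q (\<lambda>x. pmean (K x) f)"
proof -
  have "pmean (bind_pmf q K) f = (\<Sum>y\<in>UNIV. \<Sum>x\<in>UNIV. pmf q x * pmf (K x) y * f y)"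
    by (simp add: pmean_def pmf_bind expectation_eq_pmean sum_distrib_right)
  also have "\<dots> = (\<Sum>x\<in>UNIV. \<Sum>y\<in>UNIV. pmf q x * pmf (K x) y * f y)"
    by (rule sum.swap)
  finally show ?thesis by (simp add: pmean_def sum_distrib_left mult.assoc)
qed

lemma pmean_return [simp]: "pmean (return_pmf x) f = f x"
  by (simp add: pmean_def pmf_return indicator_def of_bool_def if_distrib[of "\<lambda>c. c * _"] cong: if_cong)

text \<open>The bias-variance decomposition. It makes the mean the best constant approximation in
  mean square, which is what \<open>pvar_perturb\<close> needs.\<close>

lemma pmean_square_dist: "pmean q (\<lambda>x. (f x - c)^2) = pvar q f + (pmean q f - c)^2"
proof -
  have *: "pmean q (\<lambda>x. (f x - d)^2) = pmean q (\<lambda>x. (f x)^2) - 2 * d * pmean q f + d^2" for d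
  proof -
    have "pmean q (\<lambda>x. (f x - d)^2) = pmean q (\<lambda>x. ((f x)^2 - (2 * d) * f x) + d^2)"
      by (rule arg_cong[of _ _ "pmean q"]) (simp add: power2_eq_square algebra_simps)
    then show ?thesis unfolding pmean_add pmean_diff pmean_cmult by simp
  qed
  show ?thesis unfolding pvar_def * by (simp add: power2_eq_square algebra_simps)
qed

lemma pvar_shift: "pvar q f = pmean q (\<lambda>x. (f x - c)^2) - (pmean q (\<lambda>x. f x - c))^2"
  by (simp add: pmean_square_dist pmean_diff)

text \<open>Replacing the centre of \<open>f\<close> by the mean of \<open>g\<close> can only
  increase the second moment; \<open>(a + b)^2 \<le> 2 * a^2 + 2 * b^2\<close> then separates the
  perturbation from the variance of \<open>g\<close>.\<close>

lemma pvar_perturb: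
  assumes "\<And>x. \<bar>f x - g x\<bar> \<le> \<eta>"
  shows "pvar q f \<le> 2 * pvar q g + 2 * \<eta>^2"
proof -
  have "pvar q f \<le> pmean q (\<lambda>x. (f x - pmean q g)^2)"
    by (simp add: pmean_square_dist)
  also have "\<dots> \<le> pmean q (\<lambda>x. 2 * (g x - pmean q g)^2 + 2 * \<eta>^2)"
  proof (rule pmean_mono)
    fix x
    have "(f x - g x)^2 \<le> \<eta>^2" using assms[of x] by (intro power2_le_iff_abs_le[THEN iffD2]) auto
    moreover have "(f x - pmean q g)^2 \<le> 2 * (g x - pmean q g)^2 + 2 * (f x - g x)^2"
      using zero_le_power2[of "(f x - g x) - (g x - pmean q g)"]
      by (simp add: power2_eq_square algebra_simps)
    ultimately show "(f x - pmean q g)^2 \<le> 2 * (g x - pmean q g)^2 + 2 * \<eta>^2" by linarith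
  qed
  also have "\<dots> = 2 * pvar q g + 2 * \<eta>^2"
    by (simp add: pmean_add pmean_cmult pvar_def)
  finally show ?thesis .
qed

lemma obtain_maximizer:
  fixes f :: "'s::finite \<Rightarrow> real"
  obtains s where "\<And>x. f x \<le> f s"
proof -
  have "Max (range f) \<in> range f" by (rule Max_in) auto
  then obtain s where "Max (range f) = f s" by blast
  then have "f x \<le> f s" for x by (metis Max_ge finite finite_imageI rangeI)
  then show ?thesis using that by blast
qed

lemma obtain_minimizer:
  fixes f :: "'s::finite \<Rightarrow> real"
  obtains s where "\<And>x. f s \<le> f x"
proof -
  obtain s where "\<And>x. - f x \<le> - f s" using obtain_maximizer[of "\<lambda>x. - f x"] by blast
  then show ?thesis using that[of s] by simp
qed

section \<open>Fixed points of sup-norm contractions\<close>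

text \<open>Quantifying over all uniform bounds \<open>c\<close> expresses a sup-norm contraction
  without a norm on the function type.\<close>

definition contraction :: "real \<Rightarrow> (('s::finite \<Rightarrow> real) \<Rightarrow> 's \<Rightarrow> real) \<Rightarrow> bool" where
  "contraction \<gamma> T \<longleftrightarrow>
     (\<forall>v w c. (\<forall>s. \<bar>v s - w s\<bar> \<le> c) \<longrightarrow> (\<forall>s. \<bar>T v s - T w s\<bar> \<le> \<gamma> * c))"

lemma contractionD:
  "contraction \<gamma> T \<Longrightarrow> (\<And>s. \<bar>v s - w s\<bar> \<le> c) \<Longrightarrow> \<bar>T v s - T w s\<bar> \<le> \<gamma> * c"
  unfolding contraction_def by blast

lemma contraction_fixpoint_diff:
  fixes v w :: "'s::finite \<Rightarrow> real"
  assumes T: "contraction \<gamma> T" and \<gamma>: "\<gamma> < 1"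
    and v: "\<And>s. v s = T v s" and w: "\<And>s. w s = U w s"
    and TU: "\<And>s. \<bar>T w s - U w s\<bar> \<le> d"
  shows "\<bar>v s - w s\<bar> \<le> d / (1 - \<gamma>)"
proof -
  obtain s0 where s0: "\<And>x. \<bar>v x - w x\<bar> \<le> \<bar>v s0 - w s0\<bar>"
    using obtain_maximizer[of "\<lambda>x. \<bar>v x - w x\<bar>"] by blast
  have "\<bar>v s0 - w s0\<bar> \<le> \<bar>T v s0 - T w s0\<bar> + \<bar>T w s0 - U w s0\<bar>"
    using v[of s0] w[of s0] by linarith
  also have "\<dots> \<le> \<gamma> * \<bar>v s0 - w s0\<bar> + d"
    using contractionD[OF T, of v w "\<bar>v s0 - w s0\<bar>" s0] s0 TU[of s0] by fastforce
  finally have "\<bar>v s0 - w s0\<bar> * (1 - \<gamma>) \<le> d" by (simp add: algebra_simps)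
  then have "\<bar>v s0 - w s0\<bar> \<le> d / (1 - \<gamma>)" using \<gamma> by (simp add: pos_le_divide_eq)
  then show ?thesis using s0[of s] by linarith
qed

lemma contraction_fixpoint_unique:
  fixes v w :: "'s::finite \<Rightarrow> real"
  assumes "contraction \<gamma> T" "\<gamma> < 1" "\<And>s. v s = T v s" "\<And>s. w s = T w s"
  shows "v = w"
  using contraction_fixpoint_diff[where T=T and U=T and v=v and w=w and d=0 and \<gamma>=\<gamma>] assms by fastforce

text \<open>Banach iteration from zero. Convergence of the iterates is exported as well, because it
  later makes the optimal value measurable in the rewards.\<close>

lemma contraction_fixpoint_exists:
  fixes T :: "('s::finite \<Rightarrow> real) \<Rightarrow> 's \<Rightarrow> real"
  assumes T: "contraction \<gamma> T" and \<gamma>: "0 \<le> \<gamma>" "\<gamma> < 1"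
  obtains v where "\<And>s. v s = T v s" "\<And>s. (\<lambda>k. (T ^^ k) (\<lambda>_. 0) s) \<longlonglongrightarrow> v s"
proof -
  define u where "u k = (T ^^ k) (\<lambda>_. 0)" for k
  have uS: "u (Suc k) = T (u k)" for k by (simp add: u_def)
  obtain s0 where s0: "\<And>x. \<bar>u 1 x - u 0 x\<bar> \<le> \<bar>u 1 s0 - u 0 s0\<bar>"
    using obtain_maximizer[of "\<lambda>x. \<bar>u 1 x - u 0 x\<bar>"] by blast
  define C where "C = \<bar>u 1 s0 - u 0 s0\<bar>"
  have step: "\<bar>u (Suc k) s - u k s\<bar> \<le> \<gamma> ^ k * C" for k s
  proof (induction k arbitrary: s)
    case 0 then show ?case using s0 by (simp add: C_def)
  next
    case (Suc k)
    show ?case using contractionD[OF T, where v="u (Suc k)" and w="u k" and s=s, OF Suc.IH]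
      by (simp only: uS power_Suc mult.assoc)
  qed
  have "summable (\<lambda>k. u (Suc k) s - u k s)" for s
    by (rule summable_comparison_test'[of "\<lambda>k. \<gamma> ^ k * C" 0])
       (use step \<gamma> in \<open>auto intro!: summable_mult2 summable_geometric\<close>)
  then have "convergent (\<lambda>k. u k s - u 0 s)" for s
    unfolding summable_iff_convergent
    using sum_lessThan_telescope[of "\<lambda>k. u k s"] by (metis (no_types, lifting) ext)
  then have "convergent (\<lambda>k. u k s)" for s
    using convergent_add[OF _ convergent_const, of "\<lambda>k. u k s - u 0 s" "u 0 s"] by simp
  then obtain v where v: "\<And>s. (\<lambda>k. u k s) \<longlonglongrightarrow> v s"
    unfolding convergent_def by metis
  have "v s = T v s" for s
  proof -
    \<comment> \<open>The finite sum of the gaps dominates each of them, so it is a uniform bound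
      that the contraction accepts, and it tends to zero by pointwise convergence alone.\<close>
    have "(\<lambda>k. \<gamma> * (\<Sum>x\<in>UNIV. \<bar>u k x - v x\<bar>)) \<longlonglongrightarrow> \<gamma> * (\<Sum>x\<in>UNIV. \<bar>v x - v x\<bar>)"
      by (intro tendsto_intros v)
    then have lim0: "(\<lambda>k. \<gamma> * (\<Sum>x\<in>UNIV. \<bar>u k x - v x\<bar>)) \<longlonglongrightarrow> 0" by simp
    have "\<bar>T (u k) s - T v s\<bar> \<le> \<gamma> * (\<Sum>x\<in>UNIV. \<bar>u k x - v x\<bar>)" for k
      by (rule contractionD[OF T]) (rule member_le_sum[where f="\<lambda>x. \<bar>u k x - v x\<bar>"], auto)
    then have "(\<lambda>k. T (u k) s - T v s) \<longlonglongrightarrow> 0"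
      by (intro Lim_null_comparison[OF _ lim0]) auto
    then have "(\<lambda>k. u (Suc k) s) \<longlonglongrightarrow> T v s"
      unfolding uS by (rule LIM_zero_cancel)
    then show ?thesis using LIMSEQ_unique[OF LIMSEQ_Suc[OF v[of s]]] by simp
  qed
  then show ?thesis using that v unfolding u_def by blast
qed

section \<open>Discounted values of a stationary policy\<close>

text \<open>Maximum principle: at a maximiser of \<open>y\<close> the mean of \<open>y\<close> is at
  most \<open>y\<close> itself, so the inequality can be solved there.\<close>

lemma discounted_supersolution:
  fixes K :: "'s::finite \<Rightarrow> 's pmf"
  assumes \<gamma>: "0 \<le> \<gamma>" "\<gamma> < 1" and y: "\<And>s. y s \<le> C + \<gamma> * pmean (K s) y"
  shows "y s \<le> C / (1 - \<gamma>)"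
proof -
  obtain s0 where s0: "\<And>x. y x \<le> y s0" using obtain_maximizer[of y] by blast
  have "y s0 \<le> C + \<gamma> * y s0"
    using y[of s0] mult_left_mono[OF pmean_le[of y "y s0" "K s0", OF s0] \<gamma>(1)] by linarith
  then have "y s0 \<le> C / (1 - \<gamma>)" using \<gamma> by (simp add: pos_le_divide_eq algebra_simps)
  then show ?thesis using s0[of s] by linarith
qed

lemma contraction_policy:
  fixes K :: "'s::finite \<Rightarrow> 's pmf"
  assumes "0 \<le> \<gamma>" shows "contraction \<gamma> (\<lambda>v s. f s + \<gamma> * pmean (K s) v)"
  unfolding contraction_def
proof (intro allI impI)
  fix v w :: "'s \<Rightarrow> real" and c s assume "\<forall>s. \<bar>v s - w s\<bar> \<le> c"
  then have "\<bar>pmean (K s) v - pmean (K s) w\<bar> \<le> c" by (intro pmean_abs_diff_le) auto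
  then show "\<bar>f s + \<gamma> * pmean (K s) v - (f s + \<gamma> * pmean (K s) w)\<bar> \<le> \<gamma> * c"
    using assms by (simp add: right_diff_distrib[symmetric] abs_mult mult_left_mono)
qed

lemma policy_value_exists:
  fixes K :: "'s::finite \<Rightarrow> 's pmf"
  assumes "0 \<le> \<gamma>" "\<gamma> < 1"
  obtains v where "\<And>s. v s = f s + \<gamma> * pmean (K s) v"
  using contraction_fixpoint_exists[OF contraction_policy[OF assms(1), of f K] assms] by metis

text \<open>The total-variance bound in resolvent-free form: \<open>2 k (B - (v - lo))\<^sup>2\<close> is a Lyapunov
  function whose drift absorbs the variance term \<open>k * pvar\<close>, so that only \<open>O(k B)\<close>
  per step is left to be discounted.\<close>

lemma total_variance_bound:
  fixes K :: "'s::finite \<Rightarrow> 's pmf"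
  assumes \<gamma>: "0 \<le> \<gamma>" "\<gamma> < 1"
    and x: "\<And>s. x s \<le> e s + \<gamma> * pmean (K s) x"
    and e: "\<And>s. e s \<le> k * pvar (K s) v + l" "\<And>s. 0 \<le> e s"
    and v: "\<And>s. lo \<le> v s" "\<And>s. v s \<le> lo + B"
    and drift: "\<And>s. v s - pmean (K s) v \<ge> - (C + e s)"
    and k: "0 \<le> k" "2 * B * k \<le> 1 / 2" and C: "0 \<le> C"
  shows "x s \<le> (4 * B * k * C + 2 * l) / (1 - \<gamma>) + 2 * k * B^2"
proof -
  define w where "w s = v s - lo" for s
  define g where "g s = 2 * k * (B - w s)^2" for s
  have w: "0 \<le> w s" "w s \<le> B" for s using v[of s] by (auto simp: w_def)
  have pw: "0 \<le> pmean (K s) w" "pmean (K s) w \<le> B" for s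
    by (auto intro: pmean_le pmean_ge w)
  have g: "0 \<le> g s" "g s \<le> 2 * k * B^2" for s
    using k(1) w[of s] by (auto simp: g_def intro!: mult_left_mono power_mono)
  have pg: "pmean (K s) g = 2 * k * (pmean (K s) (\<lambda>x. (w x)^2) - 2 * B * pmean (K s) w + B^2)" for s
  proof -
    have "pmean (K s) g = pmean (K s) (\<lambda>x. (2 * k) * (((w x)^2 - (2 * B) * w x) + B^2))"
      by (rule arg_cong[of _ _ "pmean (K s)"]) (auto simp: g_def power2_eq_square algebra_simps)
    then show ?thesis unfolding pmean_cmult pmean_add pmean_diff by simp
  qed
  have eb: "e s \<le> pmean (K s) g - g s + (4 * B * k * C + 2 * l)" for s
  proof -
    let ?m = "pmean (K s) w" and ?m2 = "pmean (K s) (\<lambda>x. (w x)^2)"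
    have var: "pvar (K s) v = ?m2 - ?m^2"
      unfolding w_def by (rule pvar_shift)
    have mm: "v s - pmean (K s) v = w s - ?m" by (simp add: w_def [abs_def] pmean_diff)
    \<comment> \<open>The difference \<open>(w s)^2 - ?m^2\<close> is factored. The drift hypothesis
      makes the enlarged first factor nonnegative, so the second may be replaced by its upper bound
      \<open>2 * B\<close>.\<close>
    have "(w s - ?m) * (w s + ?m) \<le> (w s - ?m + C + e s) * (w s + ?m)"
      using w[of s] pw[of s] C e(2)[of s] by (intro mult_right_mono) auto
    also have "\<dots> \<le> (w s - ?m + C + e s) * (2 * B)"
      using drift[of s] w[of s] pw[of s] unfolding mm by (intro mult_left_mono) auto
    finally have "(w s)^2 - ?m^2 \<le> (w s - ?m + C + e s) * (2 * B)"
      by (simp add: power2_eq_square algebra_simps)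
    then have "pvar (K s) v \<le> ?m2 - (w s)^2 + (w s - ?m + C + e s) * (2 * B)"
      unfolding var by linarith
    then have "k * pvar (K s) v \<le> k * (?m2 - (w s)^2 + (w s - ?m + C + e s) * (2 * B))"
      using k(1) by (rule mult_left_mono)
    also have "\<dots> = k * (?m2 - (w s)^2 + (w s - ?m + C) * (2 * B)) + (2 * B * k) * e s"
      by (simp add: algebra_simps)
    \<comment> \<open>As \<open>2 * B * k \<le> 1 / 2\<close>, at most half of \<open>e s\<close>
      reappears on the right. Moving it to the left doubles the remaining terms, which is the factor
      2 in \<open>g\<close>.\<close>
    also have "\<dots> \<le> k * (?m2 - (w s)^2 + (w s - ?m + C) * (2 * B)) + 1 / 2 * e s"
      using mult_right_mono[OF k(2) e(2)[of s]] by linarith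
    finally have "e s \<le> 2 * (k * (?m2 - (w s)^2 + (w s - ?m + C) * (2 * B))) + 2 * l"
      using e(1)[of s] by linarith
    also have "\<dots> = pmean (K s) g - g s + (4 * B * k * C + 2 * l)"
      unfolding pg g_def by (simp add: power2_eq_square algebra_simps)
    finally show ?thesis .
  qed
  \<comment> \<open>Adding \<open>g\<close> to \<open>x\<close> cancels the increment
    \<open>pmean (K s) g - g s\<close>; because of discounting only
    \<open>(1 - \<gamma>) * pmean (K s) g\<close> survives.\<close>
  have "x s + g s \<le> ((4 * B * k * C + 2 * l) + (1 - \<gamma>) * (2 * k * B^2)) / (1 - \<gamma>)"
  proof (rule discounted_supersolution[OF \<gamma>])
    fix s
    have "(1 - \<gamma>) * pmean (K s) g \<le> (1 - \<gamma>) * (2 * k * B^2)"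
      using \<gamma> by (intro mult_left_mono pmean_le g) auto
    then show "x s + g s \<le> (4 * B * k * C + 2 * l) + (1 - \<gamma>) * (2 * k * B^2)
        + \<gamma> * pmean (K s) (\<lambda>s. x s + g s)"
      using x[of s] eb[of s] by (simp add: pmean_add algebra_simps)
  qed
  also have "\<dots> = (4 * B * k * C + 2 * l) / (1 - \<gamma>) + 2 * k * B^2"
    using \<gamma> by (simp add: add_divide_distrib)
  finally show ?thesis using g(1)[of s] by linarith
qed

section \<open>Minorization, mixing and average reward\<close>

abbreviation step :: "('s::finite \<Rightarrow> 'a \<Rightarrow> 's pmf) \<Rightarrow> ('s \<Rightarrow> 'a) \<Rightarrow> 's \<Rightarrow> 's pmf" where
  "step p pol \<equiv> \<lambda>s. p s (pol s)"

lemma pmean_kpow_Suc: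
  "pmean (kpow p pol (Suc m) s) f = pmean (kpow p pol m s) (\<lambda>x. pmean (step p pol x) f)"
  by (simp add: pmean_bind)

lemma pmean_kpow_add:
  "pmean (kpow p pol (m + k) s) f = pmean (kpow p pol k s) (\<lambda>x. pmean (kpow p pol m x) f)"
proof (induction m arbitrary: f)
  case 0 then show ?case by simp
next
  case (Suc m) show ?case using Suc.IH by (simp only: add_Suc pmean_kpow_Suc)
qed

lemma value_unroll:
  assumes "\<And>s. x s = f s + \<gamma> * pmean (step p pol s) x"
  shows "x s = (\<Sum>k<m. \<gamma> ^ k * pmean (kpow p pol k s) f) + \<gamma> ^ m * pmean (kpow p pol m s) x"
proof (induction m)
  case 0 then show ?case by simp
next
  case (Suc m)
  have "pmean (kpow p pol m s) x = pmean (kpow p pol m s) (\<lambda>y. f y + \<gamma> * pmean (step p pol y) x)"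
    by (rule arg_cong[of _ _ "pmean _"]) (use assms in auto)
  also have "\<dots> = pmean (kpow p pol m s) f + \<gamma> * pmean (kpow p pol (Suc m) s) x"
    unfolding pmean_kpow_Suc by (simp only: pmean_add pmean_cmult)
  finally show ?case using Suc.IH by (simp add: algebra_simps del: kpow.simps)
qed

text \<open>Doeblin's argument: both laws share the component \<open>q * pmf \<psi>\<close>, whose
  contribution cancels; what remains is nonnegative with total mass \<open>1 - q\<close>.\<close>

lemma minorizes_span:
  assumes min: "minorizes p pol m q \<psi>" and f: "\<And>x. lo \<le> f x" "\<And>x. f x \<le> hi"
  shows "pmean (kpow p pol m s) f - pmean (kpow p pol m s') f \<le> (1 - q) * (hi - lo)"
proof -
  have split: "pmean (kpow p pol m s) f
      = (\<Sum>y\<in>UNIV. (pmf (kpow p pol m s) y - q * pmf \<psi> y) * f y) + q * pmean \<psi> f" for s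
    unfolding pmean_def sum_distrib_left sum.distrib[symmetric]
    by (rule sum.cong) (auto simp: algebra_simps)
  have nn: "0 \<le> pmf (kpow p pol m s) y - q * pmf \<psi> y" for s y
    using min by (auto simp: minorizes_def)
  have tot: "(\<Sum>y\<in>UNIV. (pmf (kpow p pol m s) y - q * pmf \<psi> y) * c) = (1 - q) * c" for s c
    by (simp add: sum_distrib_right[symmetric] sum_subtractf sum_distrib_left[symmetric] sum_pmf_UNIV)
  have "(\<Sum>y\<in>UNIV. (pmf (kpow p pol m s) y - q * pmf \<psi> y) * f y) \<le> (1 - q) * hi"
    unfolding tot[of s hi, symmetric] by (intro sum_mono mult_left_mono f nn)
  moreover have "(1 - q) * lo \<le> (\<Sum>y\<in>UNIV. (pmf (kpow p pol m s') y - q * pmf \<psi> y) * f y)"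
    unfolding tot[of s' lo, symmetric] by (intro sum_mono mult_left_mono f nn)
  ultimately show ?thesis unfolding split[of s] split[of s'] by (simp add: algebra_simps)
qed

text \<open>Between a best and a worst state, the first \<open>m\<close> rewards differ by at most
  \<open>m * b\<close> in total, and the remainder is contracted by \<open>1 - q\<close>. Solving
  this inequality for the span gives a bound free of the effective horizon
  \<open>1 / (1 - \<gamma>)\<close>.\<close>

lemma minorizes_value_span:
  assumes min: "minorizes p pol m q \<psi>" and q: "0 < q" "q \<le> 1" and \<gamma>: "0 \<le> \<gamma>" "\<gamma> < 1"
    and x: "\<And>s. x s = f s + \<gamma> * pmean (step p pol s) x"
    and f: "\<And>s. 0 \<le> f s" "\<And>s. f s \<le> b"
  shows "x s - x s' \<le> b * (real m / q)"
proof -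
  obtain s1 where s1: "\<And>y. x y \<le> x s1" using obtain_maximizer[of x] by blast
  obtain s2 where s2: "\<And>y. x s2 \<le> x y" using obtain_minimizer[of x] by blast
  have b: "0 \<le> b" using f[of s] by linarith
  have \<gamma>k: "0 \<le> \<gamma> ^ k" "\<gamma> ^ k \<le> 1" for k using \<gamma> by (auto simp: power_le_one)
  have "(\<Sum>k<m. \<gamma> ^ k * pmean (kpow p pol k s1) f) \<le> (\<Sum>k<m. b)"
  proof (rule sum_mono)
    fix k
    have "pmean (kpow p pol k s1) f \<le> b" "0 \<le> pmean (kpow p pol k s1) f"
      by (auto intro: pmean_le pmean_ge f)
    then show "\<gamma> ^ k * pmean (kpow p pol k s1) f \<le> b"
      using mult_mono[of "\<gamma> ^ k" 1 "pmean (kpow p pol k s1) f" b] \<gamma>k[of k] by simp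
  qed
  moreover have "0 \<le> (\<Sum>k<m. \<gamma> ^ k * pmean (kpow p pol k s2) f)"
    by (intro sum_nonneg mult_nonneg_nonneg \<gamma>k pmean_ge f)
  moreover have "\<gamma> ^ m * (pmean (kpow p pol m s1) x - pmean (kpow p pol m s2) x)
      \<le> 1 * ((1 - q) * (x s1 - x s2))"
  proof -
    have "\<gamma> ^ m * (pmean (kpow p pol m s1) x - pmean (kpow p pol m s2) x)
        \<le> \<gamma> ^ m * ((1 - q) * (x s1 - x s2))"
      by (intro mult_left_mono minorizes_span[OF min] s1 s2 \<gamma>k)
    also have "\<dots> \<le> 1 * ((1 - q) * (x s1 - x s2))"
      using q s1[of s2] by (intro mult_right_mono \<gamma>k mult_nonneg_nonneg) auto
    finally show ?thesis .
  qed
  moreover have unroll: "x s = (\<Sum>k<m. \<gamma> ^ k * pmean (kpow p pol k s) f)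
      + \<gamma> ^ m * pmean (kpow p pol m s) x" for s
    by (rule value_unroll) (rule x)
  ultimately have "x s1 - x s2 \<le> real m * b + (1 - q) * (x s1 - x s2)"
    using unroll[of s1] unroll[of s2] by (simp only: sum_constant card_lessThan right_diff_distrib)
  then have "(x s1 - x s2) * q \<le> b * real m" by (simp add: algebra_simps)
  then have "x s1 - x s2 \<le> b * (real m / q)" using q by (simp add: pos_le_divide_eq)
  then show ?thesis using s1[of s] s2[of s'] by linarith
qed

lemma t_minorize_pol_set_nonempty:
  assumes "uniformly_ergodic p"
  shows "{real m / q | m q. m \<ge> 1 \<and> 0 < q \<and> q \<le> 1 \<and> (\<exists>\<psi>. minorizes p pol m q \<psi>)} \<noteq> {}"
  using assms unfolding uniformly_ergodic_def by blast

lemma t_minorize_pol_le: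
  fixes p :: "'s::finite \<Rightarrow> 'a::finite \<Rightarrow> 's pmf"
  shows "t_minorize_pol p pol \<le> t_minorize p"
  unfolding t_minorize_def by (rule Max_ge) auto

text \<open>Every admissible ratio has \<open>m \<ge> 1\<close> and \<open>q \<le> 1\<close>. This
  later allows bounded errors to be absorbed into multiples of \<open>t_minorize p\<close>.\<close>

lemma t_minorize_ge_1:
  fixes p :: "'s::finite \<Rightarrow> 'a::finite \<Rightarrow> 's pmf"
  assumes "uniformly_ergodic p" shows "1 \<le> t_minorize p"
proof -
  have "1 \<le> t_minorize_pol p (\<lambda>_. undefined)"
    unfolding t_minorize_pol_def
  proof (rule cInf_greatest[OF t_minorize_pol_set_nonempty[OF assms]])
    fix z assume "z \<in> {real m / q | m q. m \<ge> 1 \<and> 0 < q \<and> q \<le> 1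
      \<and> (\<exists>\<psi>. minorizes p (\<lambda>_. undefined) m q \<psi>)}"
    then obtain m q where "z = real m / q" "m \<ge> 1" "0 < q" "q \<le> 1" by blast
    then show "1 \<le> z" by (simp add: pos_le_divide_eq)
  qed
  then show ?thesis using t_minorize_pol_le[of p "\<lambda>_. undefined"] by linarith
qed

text \<open>The span divided by \<open>b\<close> is a lower bound for every admissible
  \<open>m / q\<close>, hence for their infimum; attainment of the infimum is never at
  issue.\<close>

lemma policy_value_span:
  fixes p :: "'s::finite \<Rightarrow> 'a::finite \<Rightarrow> 's pmf"
  assumes erg: "uniformly_ergodic p" and \<gamma>: "0 \<le> \<gamma>" "\<gamma> < 1"
    and x: "\<And>s. x s = f s + \<gamma> * pmean (step p pol s) x"
    and f: "\<And>s. 0 \<le> f s" "\<And>s. f s \<le> b" and b: "0 < b"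
  shows "x s - x s' \<le> b * t_minorize p"
proof -
  have "(x s - x s') / b \<le> t_minorize_pol p pol"
    unfolding t_minorize_pol_def
  proof (rule cInf_greatest[OF t_minorize_pol_set_nonempty[OF erg]])
    fix z assume "z \<in> {real m / q | m q. m \<ge> 1 \<and> 0 < q \<and> q \<le> 1 \<and> (\<exists>\<psi>. minorizes p pol m q \<psi>)}"
    then obtain m q \<psi> where z: "z = real m / q" "0 < q" "q \<le> 1" "minorizes p pol m q \<psi>" by blast
    have "x s - x s' \<le> b * z"
      unfolding z(1) by (rule minorizes_value_span[OF z(4,2,3) \<gamma> x f])
    then show "(x s - x s') / b \<le> z" using b by (simp add: pos_divide_le_eq mult.commute)
  qed
  then have "x s - x s' \<le> b * t_minorize_pol p pol"
    using b by (simp add: pos_divide_le_eq mult.commute)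
  also have "\<dots> \<le> b * t_minorize p" using b t_minorize_pol_le by (intro mult_left_mono) auto
  finally show ?thesis .
qed

text \<open>The largest and smallest \<open>k\<close>-step means are monotone in \<open>k\<close>
  and their gap shrinks by \<open>1 - q\<close> every \<open>m\<close> steps, so all starting states
  are squeezed to one limit. Both the rewards and the discounted values will be substituted for
  \<open>f\<close>.\<close>

lemma kpow_pmean_convergent:
  fixes p :: "'s::finite \<Rightarrow> 'a::finite \<Rightarrow> 's pmf"
  assumes erg: "uniformly_ergodic p"
  obtains L where "\<And>s. (\<lambda>k. pmean (kpow p pol k s) f) \<longlonglongrightarrow> L"
proof -
  obtain m q \<psi> where q: "0 < q" "q \<le> 1" and min: "minorizes p pol m q \<psi>"
    using erg unfolding uniformly_ergodic_def by blast
  define g where "g k s = pmean (kpow p pol k s) f" for k s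
  define hi where "hi k = Max (range (g k))" for k
  define lo where "lo k = Min (range (g k))" for k
  have bd: "lo k \<le> g k s" "g k s \<le> hi k" for k s
    by (auto simp: hi_def lo_def)
  have gadd: "g (k + j) s = pmean (kpow p pol j s) (g k)" for k j s
    unfolding g_def[abs_def] by (rule pmean_kpow_add)
  have rng: "hi k \<in> range (g k)" "lo k \<in> range (g k)" for k
    unfolding hi_def lo_def by (auto intro!: Max_in Min_in)
  have bd': "lo k \<le> g (k + j) s" "g (k + j) s \<le> hi k" for k j s
    unfolding gadd by (intro pmean_le pmean_ge bd)+
  have hi_dec: "decseq hi"
  proof (rule decseq_SucI)
    fix k show "hi (Suc k) \<le> hi k" using rng(1)[of "Suc k"] bd'(2)[of k 1] by auto
  qed
  have lo_inc: "incseq lo"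
  proof (rule incseq_SucI)
    fix k show "lo k \<le> lo (Suc k)" using rng(2)[of "Suc k"] bd'(1)[of k 1] by auto
  qed
  have span: "hi (k + m) - lo (k + m) \<le> (1 - q) * (hi k - lo k)" for k
  proof -
    obtain s s' where ss: "hi (k + m) = g (k + m) s" "lo (k + m) = g (k + m) s'"
      using rng[of "k + m"] by blast
    show ?thesis unfolding ss gadd by (rule minorizes_span[OF min bd])
  qed
  have lohi: "lo k \<le> hi k" for k using bd[of k undefined] by linarith
  have "hi 0 \<ge> hi k" "lo 0 \<le> lo k" for k
    using hi_dec lo_inc by (auto simp: decseq_def incseq_def)
  then have bnds: "lo 0 \<le> hi k" "lo k \<le> hi 0" for k using lohi[of k] by (meson order_trans)+
  obtain L where L: "hi \<longlonglongrightarrow> L" using decseq_convergent[OF hi_dec, of "lo 0"] bnds(1) by blast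
  obtain L' where L': "lo \<longlonglongrightarrow> L'" using incseq_convergent[OF lo_inc] bnds(2) by blast
  \<comment> \<open>Passing to the limit in the span inequality replaces an estimate of the
    geometric rate.\<close>
  have "L - L' \<le> (1 - q) * (L - L')"
  proof (rule LIMSEQ_le)
    show "(\<lambda>k. hi (k + m) - lo (k + m)) \<longlonglongrightarrow> L - L'"
      by (intro tendsto_diff LIMSEQ_ignore_initial_segment L L')
    show "(\<lambda>k. (1 - q) * (hi k - lo k)) \<longlonglongrightarrow> (1 - q) * (L - L')"
      by (intro tendsto_intros L L')
  qed (use span in auto)
  then have "q * (L - L') \<le> 0" by (simp add: algebra_simps)
  then have "L \<le> L'" using q by (simp add: mult_le_0_iff)
  moreover have "L' \<le> L" by (rule LIMSEQ_le[OF L' L]) (use lohi in auto)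
  ultimately have "lo \<longlonglongrightarrow> L" using L' by simp
  then have "(\<lambda>k. g k s) \<longlonglongrightarrow> L" for s
    using bd by (intro tendsto_sandwich[of lo "\<lambda>k. g k s" sequentially hi, OF _ _ _ L] always_eventually) blast+
  then show ?thesis using that unfolding g_def by blast
qed

lemma cesaro_mean_tendsto:
  fixes a :: "nat \<Rightarrow> real"
  assumes "a \<longlonglongrightarrow> L"
  shows "(\<lambda>T. (\<Sum>t<T. a t) / real T) \<longlonglongrightarrow> L"
proof (rule LIMSEQ_I)
  fix e :: real assume e: "0 < e"
  obtain N where N: "\<And>n. n \<ge> N \<Longrightarrow> \<bar>a n - L\<bar> < e / 2"
    using LIMSEQ_D[OF assms, of "e / 2"] e by auto
  define C where "C = (\<Sum>t<N. \<bar>a t - L\<bar>)"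
  \<comment> \<open>From \<open>M\<close> on, the fixed head \<open>C\<close> is below half of
    \<open>e * T\<close>; \<open>Suc N\<close> in the threshold keeps \<open>T\<close>
    positive.\<close>
  obtain M :: nat where M: "2 * C / e < real M" using reals_Archimedean2 by blast
  have "norm ((\<Sum>t<T. a t) / real T - L) < e" if T: "T \<ge> max (Suc N) M" for T
  proof -
    have T0: "0 < real T" using T by simp
    have "\<bar>(\<Sum>t<T. a t - L)\<bar> \<le> (\<Sum>t<T. \<bar>a t - L\<bar>)" by (rule sum_abs)
    also have "\<dots> = C + (\<Sum>t=N..<T. \<bar>a t - L\<bar>)"
      using T unfolding C_def lessThan_atLeast0 by (subst sum.atLeastLessThan_concat) auto
    also have "(\<Sum>t=N..<T. \<bar>a t - L\<bar>) \<le> (\<Sum>t=N..<T. e / 2)"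
      proof (rule sum_mono)
      fix t assume "t \<in> {N..<T}"
      then show "\<bar>a t - L\<bar> \<le> e / 2" using N[of t] by simp
    qed
    also have "\<dots> \<le> real T * (e / 2)" using e by (auto intro!: mult_right_mono)
    also have "C < real T * (e / 2)"
    proof -
      have "2 * C / e < real T" using M T by linarith
      then show ?thesis using e by (simp add: pos_divide_less_eq mult.commute)
    qed
    finally have "\<bar>(\<Sum>t<T. a t - L)\<bar> < e * real T" by (simp add: algebra_simps)
    moreover have "(\<Sum>t<T. a t) / real T - L = (\<Sum>t<T. a t - L) / real T"
      using T0 by (simp add: sum_subtractf diff_divide_distrib)
    ultimately show ?thesis using T0 by (simp add: pos_divide_less_eq)
  qed
  then show "\<exists>no. \<forall>n\<ge>no. norm ((\<Sum>t<n. a t) / real n - L) < e" by blast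
qed

text \<open>An arbitrary initial law is a finite mixture of starting states, so the expected rewards
  converge to the same limit and so do their averages. Uniqueness of limits then resolves the
  \<open>THE\<close>.\<close>

lemma avg_reward_eq_limit:
  fixes p :: "'s::finite \<Rightarrow> 'a::finite \<Rightarrow> 's pmf"
  assumes L: "\<And>s. (\<lambda>k. pmean (kpow p pol k s) (\<lambda>s. r s (pol s))) \<longlonglongrightarrow> L"
  shows "avg_reward p r pol = L"
proof -
  have lim: "(\<lambda>T. (\<Sum>t<T. exp_reward p r pol \<mu> t) / real T) \<longlonglongrightarrow> L" for \<mu>
  proof (rule cesaro_mean_tendsto)
    have "exp_reward p r pol \<mu> t
        = (\<Sum>s\<in>UNIV. pmf \<mu> s * pmean (kpow p pol t s) (\<lambda>s. r s (pol s)))" for t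
      unfolding exp_reward_def expectation_eq_pmean pmean_bind by (simp add: pmean_def)
    moreover have "(\<lambda>t. \<Sum>s\<in>UNIV. pmf \<mu> s * pmean (kpow p pol t s) (\<lambda>s. r s (pol s)))
        \<longlonglongrightarrow> (\<Sum>s\<in>UNIV. pmf \<mu> s * L)"
      by (intro tendsto_intros L)
    ultimately have "(\<lambda>t. exp_reward p r pol \<mu> t) \<longlonglongrightarrow> L"
      by (simp add: sum_distrib_right[symmetric] sum_pmf_UNIV)
    then show "exp_reward p r pol \<mu> \<longlonglongrightarrow> L" .
  qed
  show ?thesis unfolding avg_reward_def
  proof (rule the_equality)
    fix \<alpha> assume *: "\<forall>\<mu>. (\<lambda>T. (\<Sum>t<T. exp_reward p r pol \<mu> t) / real T) \<longlonglongrightarrow> \<alpha>"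
    show "\<alpha> = L" by (rule LIMSEQ_unique[OF *[rule_format] lim])
  qed (use lim in simp)
qed

text \<open>The \<open>k\<close>-step kernel is applied to the equation for \<open>x\<close> and
  \<open>k\<close> tends to infinity. This gives \<open>Lx = L + \<gamma> * Lx\<close>, so the
  average reward is \<open>1 - \<gamma>\<close> times a limit of averages of \<open>x\<close>, which
  lies within one span of \<open>x s\<close>. No stationary law has to be constructed.\<close>

lemma avg_reward_discounted:
  fixes p :: "'s::finite \<Rightarrow> 'a::finite \<Rightarrow> 's pmf"
  assumes erg: "uniformly_ergodic p" and \<gamma>: "0 \<le> \<gamma>" "\<gamma> < 1"
    and r: "\<And>s a. 0 \<le> r s a" "\<And>s a. r s a \<le> 1"
    and x: "\<And>s. x s = r s (pol s) + \<gamma> * pmean (step p pol s) x"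
  shows "\<bar>avg_reward p r pol - (1 - \<gamma>) * x s\<bar> \<le> (1 - \<gamma>) * t_minorize p"
proof -
  obtain L where L: "\<And>s. (\<lambda>k. pmean (kpow p pol k s) (\<lambda>s. r s (pol s))) \<longlonglongrightarrow> L"
    using kpow_pmean_convergent[OF erg] by blast
  obtain Lx where Lx: "\<And>s. (\<lambda>k. pmean (kpow p pol k s) x) \<longlonglongrightarrow> Lx"
    using kpow_pmean_convergent[OF erg] by blast
  have eq: "pmean (kpow p pol k s) x
      = pmean (kpow p pol k s) (\<lambda>s. r s (pol s)) + \<gamma> * pmean (kpow p pol (Suc k) s) x" for k
  proof -
    have "pmean (kpow p pol k s) x
        = pmean (kpow p pol k s) (\<lambda>y. r y (pol y) + \<gamma> * pmean (step p pol y) x)"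
      by (rule arg_cong[of _ _ "pmean _"]) (use x in auto)
    then show ?thesis unfolding pmean_kpow_Suc by (simp only: pmean_add pmean_cmult)
  qed
  have "(\<lambda>k. pmean (kpow p pol k s) (\<lambda>s. r s (pol s)) + \<gamma> * pmean (kpow p pol (Suc k) s) x)
      \<longlonglongrightarrow> L + \<gamma> * Lx"
    by (intro tendsto_add tendsto_mult tendsto_const L LIMSEQ_Suc[OF Lx[of s]])
  then have "(\<lambda>k. pmean (kpow p pol k s) x) \<longlonglongrightarrow> L + \<gamma> * Lx"
    by (rule Lim_transform_eventually) (intro always_eventually allI eq[symmetric])
  then have "Lx = L + \<gamma> * Lx" using Lx[of s] LIMSEQ_unique by blast
  then have avg: "avg_reward p r pol = (1 - \<gamma>) * Lx"
    using avg_reward_eq_limit[where r=r, OF L] by (simp add: algebra_simps)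
  have span: "x y - x z \<le> t_minorize p" for y z
    using policy_value_span[where x=x and b=1 and s=y and s'=z, OF erg \<gamma> x] r by auto
  have "pmean (kpow p pol k s) x \<le> x s + t_minorize p" for k
    by (rule pmean_le) (use span[of _ s] in \<open>simp add: algebra_simps\<close>)
  then have "Lx \<le> x s + t_minorize p"
    using LIMSEQ_le_const2[OF Lx[of s]] by blast
  moreover have "x s - t_minorize p \<le> pmean (kpow p pol k s) x" for k
    by (rule pmean_ge) (use span[of s] in \<open>simp add: algebra_simps\<close>)
  then have "x s - t_minorize p \<le> Lx"
    using LIMSEQ_le_const[OF Lx[of s]] by blast
  ultimately have "\<bar>Lx - x s\<bar> \<le> t_minorize p" by linarith
  then show ?thesis unfolding avg using \<gamma>
    by (simp add: right_diff_distrib[symmetric] abs_mult mult_left_mono)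
qed

section \<open>Optimality operators and absorbing models\<close>

definition stochastic :: "('s::finite \<Rightarrow> 'a \<Rightarrow> 's \<Rightarrow> real) \<Rightarrow> bool" where
  "stochastic ph \<longleftrightarrow> (\<forall>s a s'. 0 \<le> ph s a s') \<and> (\<forall>s a. (\<Sum>s'\<in>UNIV. ph s a s') = 1)"

lemma stochastic_row_le:
  assumes "stochastic ph" "\<And>s'. v s' \<le> c"
  shows "(\<Sum>s'\<in>UNIV. ph s a s' * v s') \<le> c"
proof -
  have "(\<Sum>s'\<in>UNIV. ph s a s' * v s') \<le> (\<Sum>s'\<in>UNIV. ph s a s' * c)"
    using assms by (intro sum_mono mult_left_mono) (auto simp: stochastic_def)
  also have "\<dots> = c" using assms(1) by (simp add: stochastic_def sum_distrib_right[symmetric])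
  finally show ?thesis .
qed

lemma stochastic_row_ge:
  assumes "stochastic ph" "\<And>s'. c \<le> v s'"
  shows "c \<le> (\<Sum>s'\<in>UNIV. ph s a s' * v s')"
  using stochastic_row_le[OF assms(1), of "\<lambda>s'. - v s'" "- c"] assms(2) by (simp add: sum_negf)

lemma stochastic_row_abs_diff_le:
  assumes "stochastic ph" "\<And>s'. \<bar>v s' - w s'\<bar> \<le> c"
  shows "\<bar>(\<Sum>s'\<in>UNIV. ph s a s' * v s') - (\<Sum>s'\<in>UNIV. ph s a s' * w s')\<bar> \<le> c"
proof -
  have *: "v s' - w s' \<le> c" "- c \<le> v s' - w s'" for s' using assms(2)[of s'] by linarith+
  have "(\<Sum>s'\<in>UNIV. ph s a s' * v s') - (\<Sum>s'\<in>UNIV. ph s a s' * w s')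
      = (\<Sum>s'\<in>UNIV. ph s a s' * (v s' - w s'))"
    by (simp add: right_diff_distrib sum_subtractf)
  then show ?thesis
    using stochastic_row_le[of ph "\<lambda>s'. v s' - w s'", OF assms(1) *(1)]
      stochastic_row_ge[of ph _ "\<lambda>s'. v s' - w s'", OF assms(1) *(2)] by (simp add: abs_le_iff minus_le_iff)
qed

definition bellman_op :: "('s \<Rightarrow> 'a::finite \<Rightarrow> real) \<Rightarrow> ('s \<Rightarrow> 'a \<Rightarrow> 's \<Rightarrow> real) \<Rightarrow> real
    \<Rightarrow> ('s::finite \<Rightarrow> real) \<Rightarrow> 's \<Rightarrow> real" where
  "bellman_op R ph \<gamma> v s = Max (range (bellman R ph \<gamma> v s))"

lemma bellman_le_op: "bellman R ph \<gamma> v s a \<le> bellman_op R ph \<gamma> v s"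
  unfolding bellman_op_def by (rule Max_ge) auto

lemma bellman_op_attained:
  obtains a where "bellman_op R ph \<gamma> v s = bellman R ph \<gamma> v s a"
proof -
  have "bellman_op R ph \<gamma> v s \<in> range (bellman R ph \<gamma> v s)"
    unfolding bellman_op_def by (rule Max_in) auto
  then show ?thesis using that by blast
qed

lemma contraction_bellman_op:
  fixes ph :: "'s::finite \<Rightarrow> 'a::finite \<Rightarrow> 's \<Rightarrow> real"
  assumes ph: "stochastic ph" and \<gamma>: "0 \<le> \<gamma>"
  shows "contraction \<gamma> (bellman_op R ph \<gamma>)"
  unfolding contraction_def
proof (intro allI impI)
  fix v w :: "'s \<Rightarrow> real" and c s assume vw: "\<forall>s. \<bar>v s - w s\<bar> \<le> c"
  have *: "\<bar>bellman R ph \<gamma> v s a - bellman R ph \<gamma> w s a\<bar> \<le> \<gamma> * c" for a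
    using stochastic_row_abs_diff_le[OF ph, of v w c s a] vw \<gamma>
    by (simp add: bellman_def right_diff_distrib[symmetric] abs_mult mult_left_mono)
  \<comment> \<open>Each maximum is compared with the other one at its own maximising action, which
    bounds the difference from both sides.\<close>
  obtain a where a: "bellman_op R ph \<gamma> v s = bellman R ph \<gamma> v s a" by (rule bellman_op_attained)
  obtain b where b: "bellman_op R ph \<gamma> w s = bellman R ph \<gamma> w s b" by (rule bellman_op_attained)
  show "\<bar>bellman_op R ph \<gamma> v s - bellman_op R ph \<gamma> w s\<bar> \<le> \<gamma> * c"
    using *[of a] *[of b] bellman_le_op[of R ph \<gamma> v s b] bellman_le_op[of R ph \<gamma> w s a] a b
    by linarith
qed

text \<open>The disjunction in the hypothesis lets one argument at the extremal states serve both
  the optimal value and the absorbing values, where one state has a prescribed value.\<close>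

lemma bellman_op_range:
  assumes ph: "stochastic ph" and \<gamma>: "0 \<le> \<gamma>" "\<gamma> < 1"
    and R: "\<And>s a. 0 \<le> R s a" "\<And>s a. R s a \<le> b"
    and v: "\<And>s. v s = bellman_op R ph \<gamma> v s \<or> 0 \<le> v s \<and> v s \<le> b / (1 - \<gamma>)"
  shows "0 \<le> v s \<and> v s \<le> b / (1 - \<gamma>)"
proof -
  obtain s1 where s1: "\<And>y. v y \<le> v s1" using obtain_maximizer[of v] by blast
  obtain s2 where s2: "\<And>y. v s2 \<le> v y" using obtain_minimizer[of v] by blast
  have "v s1 \<le> b / (1 - \<gamma>)"
  proof (cases "v s1 = bellman_op R ph \<gamma> v s1")
    case True
    obtain a where "bellman_op R ph \<gamma> v s1 = bellman R ph \<gamma> v s1 a" by (rule bellman_op_attained)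
    then have "v s1 = R s1 a + \<gamma> * (\<Sum>s'\<in>UNIV. ph s1 a s' * v s')" using True by (simp add: bellman_def)
    also have "\<dots> \<le> b + \<gamma> * v s1"
      by (intro add_mono R mult_left_mono stochastic_row_le ph s1 \<gamma>)
    finally show ?thesis using \<gamma> by (simp add: pos_le_divide_eq algebra_simps)
  next
    case False then show ?thesis using v by blast
  qed
  moreover have "0 \<le> v s2"
  proof (cases "v s2 = bellman_op R ph \<gamma> v s2")
    case True
    have "0 + \<gamma> * v s2 \<le> R s2 undefined + \<gamma> * (\<Sum>s'\<in>UNIV. ph s2 undefined s' * v s')"
      by (intro add_mono R mult_left_mono stochastic_row_ge ph s2 \<gamma>)
    also have "\<dots> \<le> v s2"
      using True bellman_le_op[of R ph \<gamma> v s2 undefined] by (simp add: bellman_def)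
    finally have "0 \<le> (1 - \<gamma>) * v s2" by (simp add: algebra_simps)
    then show ?thesis using \<gamma> by (simp add: zero_le_mult_iff)
  next
    case False then show ?thesis using v by blast
  qed
  ultimately show ?thesis using s1[of s] s2[of s] by linarith
qed

lemma the_fixpoint:
  fixes T :: "('s::finite \<Rightarrow> real) \<Rightarrow> 's \<Rightarrow> real"
  assumes T: "contraction \<gamma> T" and \<gamma>: "0 \<le> \<gamma>" "\<gamma> < 1"
  defines "w \<equiv> THE v. \<forall>s. v s = T v s"
  shows "w s = T w s" "(\<And>s. v s = T v s) \<Longrightarrow> v = w" "(\<lambda>k. (T ^^ k) (\<lambda>_. 0) s) \<longlonglongrightarrow> w s"
proof -
  obtain v0 where v0: "\<And>s. v0 s = T v0 s" "\<And>s. (\<lambda>k. (T ^^ k) (\<lambda>_. 0) s) \<longlonglongrightarrow> v0 s"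
    using contraction_fixpoint_exists[OF T \<gamma>] by blast
  have uniq: "v = v0" if "\<And>s. v s = T v s" for v
    by (rule contraction_fixpoint_unique[OF T \<gamma>(2) that v0(1)])
  have "w = v0" unfolding w_def
    by (rule the_equality) (use v0(1) uniq in auto)
  then show "w s = T w s" "(\<And>s. v s = T v s) \<Longrightarrow> v = w"
    "(\<lambda>k. (T ^^ k) (\<lambda>_. 0) s) \<longlonglongrightarrow> w s"
    using v0 uniq by auto
qed

lemma disc_value_THE: "disc_value R ph \<gamma> = (THE v. \<forall>s. v s = bellman_op R ph \<gamma> v s)"
  by (simp add: disc_value_def bellman_op_def)

lemma disc_value_eq:
  assumes "stochastic ph" "0 \<le> \<gamma>" "\<gamma> < 1"
  shows "disc_value R ph \<gamma> s = bellman_op R ph \<gamma> (disc_value R ph \<gamma>) s"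
  unfolding disc_value_THE by (rule the_fixpoint(1)[OF contraction_bellman_op[OF assms(1,2)] assms(2,3)])

text \<open>Prescribing \<open>u\<close> at \<open>s0\<close> models an absorbing state with
  per-step reward \<open>(1 - \<gamma>) * u\<close>, while keeping the original kernel as the only
  parameter.\<close>

definition absorb_op :: "('s \<Rightarrow> 'a::finite \<Rightarrow> real) \<Rightarrow> ('s \<Rightarrow> 'a \<Rightarrow> 's \<Rightarrow> real) \<Rightarrow> real
    \<Rightarrow> 's \<Rightarrow> real \<Rightarrow> ('s::finite \<Rightarrow> real) \<Rightarrow> 's \<Rightarrow> real" where
  "absorb_op R ph \<gamma> s0 u v s = (if s = s0 then u else bellman_op R ph \<gamma> v s)"

definition absorb_value :: "('s \<Rightarrow> 'a::finite \<Rightarrow> real) \<Rightarrow> ('s \<Rightarrow> 'a \<Rightarrow> 's \<Rightarrow> real) \<Rightarrow> real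
    \<Rightarrow> 's \<Rightarrow> real \<Rightarrow> 's::finite \<Rightarrow> real" where
  "absorb_value R ph \<gamma> s0 u = (THE v. \<forall>s. v s = absorb_op R ph \<gamma> s0 u v s)"

lemma contraction_absorb_op:
  fixes ph :: "'s::finite \<Rightarrow> 'a::finite \<Rightarrow> 's \<Rightarrow> real"
  assumes "stochastic ph" "0 \<le> \<gamma>"
  shows "contraction \<gamma> (absorb_op R ph \<gamma> s0 u)"
  unfolding contraction_def absorb_op_def
proof (intro allI impI)
  fix v w :: "'s \<Rightarrow> real" and c s assume vw: "\<forall>s. \<bar>v s - w s\<bar> \<le> c"
  then have "0 \<le> c" using abs_ge_zero order_trans by blast
  then show "\<bar>(if s = s0 then u else bellman_op R ph \<gamma> v s)
      - (if s = s0 then u else bellman_op R ph \<gamma> w s)\<bar> \<le> \<gamma> * c"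
    using contractionD[OF contraction_bellman_op[OF assms], of v w c R s] vw assms(2) by auto
qed

lemma absorb_value_eq:
  assumes "stochastic ph" "0 \<le> \<gamma>" "\<gamma> < 1"
  shows "absorb_value R ph \<gamma> s0 u s = absorb_op R ph \<gamma> s0 u (absorb_value R ph \<gamma> s0 u) s"
  unfolding absorb_value_def
  by (rule the_fixpoint(1)[OF contraction_absorb_op[OF assms(1,2)] assms(2,3)])

text \<open>The optimal value solves the absorbing equation with its own value at \<open>s0\<close>,
  so by uniqueness it belongs to the one-parameter family indexed by \<open>u\<close>.\<close>

lemma absorb_value_at_optimum:
  assumes "stochastic ph" "0 \<le> \<gamma>" "\<gamma> < 1"
  shows "absorb_value R ph \<gamma> s0 (disc_value R ph \<gamma> s0) = disc_value R ph \<gamma>"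
  unfolding absorb_value_def
  by (rule the_fixpoint(2)[OF contraction_absorb_op[OF assms(1,2)] assms(2,3), symmetric])
     (auto simp: absorb_op_def disc_value_eq[OF assms, symmetric])

text \<open>Away from \<open>s0\<close> the largest gap would be contracted by \<gamma> and so
  vanish; at \<open>s0\<close> it equals \<open>\<bar>u - u'\<bar>\<close>. A finite net of
  parameters therefore suffices.\<close>

lemma absorb_value_lipschitz:
  assumes ph: "stochastic ph" and \<gamma>: "0 \<le> \<gamma>" "\<gamma> < 1"
  shows "\<bar>absorb_value R ph \<gamma> s0 u s - absorb_value R ph \<gamma> s0 u' s\<bar> \<le> \<bar>u - u'\<bar>"
proof -
  define v where "v = absorb_value R ph \<gamma> s0 u"
  define w where "w = absorb_value R ph \<gamma> s0 u'"
  have v: "v s = absorb_op R ph \<gamma> s0 u v s" and w: "w s = absorb_op R ph \<gamma> s0 u' w s" for s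
    unfolding v_def w_def by (rule absorb_value_eq[OF ph \<gamma>])+
  obtain s1 where s1: "\<And>x. \<bar>v x - w x\<bar> \<le> \<bar>v s1 - w s1\<bar>"
    using obtain_maximizer[of "\<lambda>x. \<bar>v x - w x\<bar>"] by blast
  have "\<bar>v s1 - w s1\<bar> \<le> \<bar>u - u'\<bar>"
  proof (cases "s1 = s0")
    case True then show ?thesis using v[of s1] w[of s1] by (simp add: absorb_op_def)
  next
    case False
    then have "\<bar>v s1 - w s1\<bar> \<le> \<gamma> * \<bar>v s1 - w s1\<bar>"
      using v[of s1] w[of s1] contractionD[OF contraction_bellman_op[OF ph \<gamma>(1)], of v w _ R s1] s1
      by (simp add: absorb_op_def)
    then have "(1 - \<gamma>) * \<bar>v s1 - w s1\<bar> \<le> 0" by (simp add: algebra_simps)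
    then show ?thesis using \<gamma> by (simp add: mult_le_0_iff)
  qed
  then show ?thesis using s1[of s] unfolding v_def w_def by linarith
qed

text \<open>The row at \<open>s0\<close> is never read by the operator. This is the source of
  independence from the samples drawn at \<open>s0\<close>.\<close>

lemma absorb_value_cong:
  assumes "\<And>s a s'. s \<noteq> s0 \<Longrightarrow> ph s a s' = ph' s a s'"
  shows "absorb_value R ph \<gamma> s0 u = absorb_value R ph' \<gamma> s0 u"
proof -
  have "absorb_op R ph \<gamma> s0 u = absorb_op R ph' \<gamma> s0 u"
    by (intro ext) (simp add: absorb_op_def bellman_op_def bellman_def assms)
  then show ?thesis by (simp add: absorb_value_def)
qed

lemma absorb_value_range:
  assumes "stochastic ph" "0 \<le> \<gamma>" "\<gamma> < 1"
    and "\<And>s a. 0 \<le> R s a" "\<And>s a. R s a \<le> b" "0 \<le> u" "u \<le> b / (1 - \<gamma>)"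
  shows "0 \<le> absorb_value R ph \<gamma> s0 u s \<and> absorb_value R ph \<gamma> s0 u s \<le> b / (1 - \<gamma>)"
proof (rule bellman_op_range[where R=R, OF assms(1-5)])
  fix s
  show "absorb_value R ph \<gamma> s0 u s = bellman_op R ph \<gamma> (absorb_value R ph \<gamma> s0 u) s
      \<or> 0 \<le> absorb_value R ph \<gamma> s0 u s \<and> absorb_value R ph \<gamma> s0 u s \<le> b / (1 - \<gamma>)"
    using absorb_value_eq[OF assms(1-3), of R s0 u s] assms(6,7)
    unfolding absorb_op_def by (cases "s = s0") simp_all
qed

lemma disc_value_range:
  assumes "stochastic ph" "0 \<le> \<gamma>" "\<gamma> < 1"
    and "\<And>s a. 0 \<le> R s a" "\<And>s a. R s a \<le> b"
  shows "0 \<le> disc_value R ph \<gamma> s \<and> disc_value R ph \<gamma> s \<le> b / (1 - \<gamma>)"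
  using disc_value_eq[OF assms(1-3), of R] by (intro bellman_op_range[where R=R, OF assms] disjI1)

lemma greedy_value:
  assumes "stochastic ph" "0 \<le> \<gamma>" "\<gamma> < 1" "greedy R ph \<gamma> pol"
  shows "disc_value R ph \<gamma> s = bellman R ph \<gamma> (disc_value R ph \<gamma>) s (pol s)"
proof (rule antisym)
  obtain a where "bellman_op R ph \<gamma> (disc_value R ph \<gamma>) s = bellman R ph \<gamma> (disc_value R ph \<gamma>) s a"
    by (rule bellman_op_attained)
  then show "disc_value R ph \<gamma> s \<le> bellman R ph \<gamma> (disc_value R ph \<gamma>) s (pol s)"
    using assms(4) disc_value_eq[OF assms(1-3), of R s] by (simp add: greedy_def)
  show "bellman R ph \<gamma> (disc_value R ph \<gamma>) s (pol s) \<le> disc_value R ph \<gamma> s"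
    using bellman_le_op disc_value_eq[OF assms(1-3), of R s] by simp
qed

section \<open>Near-optimality of greedy policies\<close>

text \<open>The gap splits as \<open>(y - v) + (v - u) + (u - x)\<close>, with \<open>u\<close> the
  true value of the greedy policy under the perturbed rewards \<open>R\<close>. The first two parts
  are at most \<open>E\<close> by \<open>total_variance_bound\<close>. Since \<open>E\<close>
  involves the span \<open>B\<close> of \<open>v\<close>, the estimate is closed by bounding
  \<open>B\<close> in terms of \<open>E\<close> again.\<close>

lemma greedy_policy_suboptimality:
  fixes p :: "'s::finite \<Rightarrow> 'a::finite \<Rightarrow> 's pmf"
  assumes erg: "uniformly_ergodic p" and \<gamma>: "0 \<le> \<gamma>" "\<gamma> < 1"
    and ph: "stochastic ph"
    and r: "\<And>s a. 0 \<le> r s a" "\<And>s a. r s a \<le> 1"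
    and R: "\<And>s a. r s a \<le> R s a" "\<And>s a. R s a \<le> r s a + \<zeta>" and \<zeta>: "\<zeta> \<le> 1"
    and err: "\<And>s a. \<bar>(\<Sum>s'\<in>UNIV. ph s a s' * disc_value R ph \<gamma> s') - pmean (p s a) (disc_value R ph \<gamma>)\<bar>
        \<le> (1 - \<gamma>) / 500 * pvar (p s a) (disc_value R ph \<gamma>) + l"
    and l: "l \<le> 3 / 5 * (1 - \<gamma>) * t_minorize p"
    and greedy: "greedy R ph \<gamma> pol"
    and x: "\<And>s. x s = r s (pol s) + \<gamma> * pmean (step p pol s) x"
    and y: "\<And>s. y s = r s (pol' s) + \<gamma> * pmean (step p pol' s) y"
  shows "y s - x s \<le> 3 * t_minorize p + \<zeta> / (1 - \<gamma>)"
proof -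
  define v where "v = disc_value R ph \<gamma>"
  define t where "t = t_minorize p"
  define row where "row s a = (\<Sum>s'\<in>UNIV. ph s a s' * v s')" for s a
  define e where "e s a = \<bar>row s a - pmean (p s a) v\<bar>" for s a
  have t: "1 \<le> t" unfolding t_def by (rule t_minorize_ge_1[OF erg])
  have R0: "0 \<le> R s a" "R s a \<le> 2" for s a using R[of s a] r[of s a] \<zeta> by linarith+
  have v_range: "0 \<le> v s" "v s \<le> 2 / (1 - \<gamma>)" for s
    using disc_value_range[where s=s, OF ph \<gamma> R0] by (auto simp: v_def)
  have e: "e s a \<le> (1 - \<gamma>) / 500 * pvar (p s a) v + l" "0 \<le> e s a" for s a
    using err[of s a] by (auto simp: e_def row_def v_def)
  have e_abs: "\<gamma> * (row s a - pmean (p s a) v) \<le> e s a"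
    "- e s a \<le> \<gamma> * (row s a - pmean (p s a) v)" for s a
  proof -
    have "\<bar>\<gamma> * (row s a - pmean (p s a) v)\<bar> \<le> 1 * e s a"
      unfolding abs_mult e_def using \<gamma> by (intro mult_right_mono) auto
    then show "\<gamma> * (row s a - pmean (p s a) v) \<le> e s a"
      "- e s a \<le> \<gamma> * (row s a - pmean (p s a) v)" by linarith+
  qed
  obtain s1 where s1: "\<And>y. v y \<le> v s1" using obtain_maximizer[of v] by blast
  obtain s2 where s2: "\<And>y. v s2 \<le> v y" using obtain_minimizer[of v] by blast
  define B where "B = v s1 - v s2"
  have B: "0 \<le> B" "B * (1 - \<gamma>) \<le> 2"
  proof -
    have "B \<le> 2 / (1 - \<gamma>)" using v_range[of s1] v_range[of s2] by (simp add: B_def)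
    then show "B * (1 - \<gamma>) \<le> 2" using \<gamma> by (simp add: pos_le_divide_eq)
  qed (use s1 in \<open>simp add: B_def\<close>)
  \<comment> \<open>With \<open>k = (1 - \<gamma>) / 500\<close> and \<open>C = 2\<close>, the
    total-variance bound yields \<open>8 / 500 * B\<close> from the drift,
    \<open>4 / 500 * B\<close> from the potential because \<open>B * (1 - \<gamma>) \<le> 2\<close>,
    and \<open>6 / 5 * t\<close> from \<open>l\<close>.\<close>
  define E where "E = 12 / 500 * B + 6 / 5 * t"
  have opt: "R s a + \<gamma> * row s a \<le> v s" for s a
    using bellman_le_op[of R ph \<gamma> v s a] disc_value_eq[OF ph \<gamma>, of R s]
    by (simp add: v_def row_def bellman_def)
  \<comment> \<open>The policy \<open>q\<close> is arbitrary: the bound is used along the greedy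
    policy in both directions and along the comparison policy in one.\<close>
  have bound: "z s \<le> E"
    if z: "\<And>s. z s \<le> e s (q s) + \<gamma> * pmean (p s (q s)) z" for z q s
  proof -
    have "z s \<le> (4 * B * ((1 - \<gamma>) / 500) * 2 + 2 * l) / (1 - \<gamma>) + 2 * ((1 - \<gamma>) / 500) * B^2"
    proof (rule total_variance_bound[OF \<gamma> z e(1) e(2)])
      show "v s2 \<le> v s" "v s \<le> v s2 + B" for s using s1[of s] s2[of s] by (auto simp: B_def)
      show "2 * B * ((1 - \<gamma>) / 500) \<le> 1 / 2" using B by simp
      fix s
      \<comment> \<open>The drift constant is 2: optimality and nonnegative rewards give
        \<open>v s \<ge> \<gamma> * pmean (p s (q s)) v - e s (q s)\<close>, and the missing
        \<open>(1 - \<gamma>) * pmean (p s (q s)) v\<close> is at most 2.\<close>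
      have "(1 - \<gamma>) * pmean (p s (q s)) v \<le> (1 - \<gamma>) * (2 / (1 - \<gamma>))"
        using \<gamma> by (intro mult_left_mono pmean_le v_range) auto
      also have "\<dots> = 2" using \<gamma> by (simp add: field_simps)
      finally show "- (2 + e s (q s)) \<le> v s - pmean (p s (q s)) v"
        using opt[of s "q s"] R0(1)[of s "q s"] e_abs(2)[of s "q s"] by (simp add: algebra_simps)
    qed (use \<gamma> in auto)
    also have "(4 * B * ((1 - \<gamma>) / 500) * 2 + 2 * l) / (1 - \<gamma>) = 8 / 500 * B + 2 * (l / (1 - \<gamma>))"
      using \<gamma> by (simp add: field_simps)
    also have "l / (1 - \<gamma>) \<le> 3 / 5 * t" using l \<gamma> by (simp add: pos_divide_le_eq t_def mult_ac)
    also have "2 * ((1 - \<gamma>) / 500) * B^2 \<le> 4 / 500 * B"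
      using mult_right_mono[OF B(2,1)] by (simp add: power2_eq_square algebra_simps)
    finally show ?thesis by (simp add: E_def)
  qed
  obtain u where u: "\<And>s. u s = R s (pol s) + \<gamma> * pmean (step p pol s) u"
    using policy_value_exists[OF \<gamma>, of "\<lambda>s. R s (pol s)" "step p pol"] by blast
  have vg: "v s = R s (pol s) + \<gamma> * row s (pol s)" for s
    using greedy_value[OF ph \<gamma> greedy, of s] by (simp add: v_def row_def bellman_def)
  have vu: "v s - u s \<le> E" for s
  proof (rule bound[of "\<lambda>s. v s - u s" pol])
    fix s show "v s - u s \<le> e s (pol s) + \<gamma> * pmean (step p pol s) (\<lambda>s. v s - u s)"
      using vg[of s] u[of s] e_abs(1)[of s "pol s"] unfolding pmean_diff right_diff_distrib by linarith
  qed
  have uv: "u s - v s \<le> E" for s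
  proof (rule bound[of "\<lambda>s. u s - v s" pol])
    fix s show "u s - v s \<le> e s (pol s) + \<gamma> * pmean (step p pol s) (\<lambda>s. u s - v s)"
      using vg[of s] u[of s] e_abs(2)[of s "pol s"] unfolding pmean_diff right_diff_distrib by linarith
  qed
  have "u s1 - u s2 \<le> 2 * t"
    unfolding t_def by (rule policy_value_span[OF erg \<gamma> u]) (use R0 in auto)
  \<comment> \<open>Rewards up to 2 give \<open>u\<close> span \<open>2 * t\<close>, and
    \<open>u\<close> is within \<open>E\<close> of \<open>v\<close>. The coefficient
    \<open>12 / 500\<close> of \<open>B\<close> in \<open>E\<close> is small enough to solve for
    \<open>E\<close>.\<close>
  then have "B \<le> 2 * t + 2 * E" using vu[of s1] uv[of s2] by (simp add: B_def)
  then have "2 * E \<le> 3 * t" using t by (simp add: E_def)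
  \<comment> \<open>Only an upper bound is wanted here, so \<open>opt\<close> suffices for the
    actions of \<open>pol'\<close>, and \<open>r \<le> R\<close> makes the perturbation free on this
    side.\<close>
  moreover have "y s - v s \<le> E"
  proof (rule bound[of "\<lambda>s. y s - v s" pol'])
    fix s show "y s - v s \<le> e s (pol' s) + \<gamma> * pmean (step p pol' s) (\<lambda>s. y s - v s)"
      using y[of s] opt[of s "pol' s"] R(1)[of s "pol' s"] e_abs(2)[of s "pol' s"]
      by (simp add: pmean_diff algebra_simps)
  qed
  moreover have "u s - x s \<le> \<zeta> / (1 - \<gamma>)"
  proof (rule discounted_supersolution[OF \<gamma>])
    fix s show "u s - x s \<le> \<zeta> + \<gamma> * pmean (step p pol s) (\<lambda>s. u s - x s)"
      using u[of s] x[of s] R(2)[of s "pol s"] by (simp add: pmean_diff algebra_simps)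
  qed
  ultimately show ?thesis using vu[of s] by (simp add: t_def)
qed

text \<open>The factor 5 is 3 from the discounted gap plus 1 for each of the two conversions between
  discounted and average reward. The conversion holds at every state, so one arbitrary state is
  enough.\<close>

lemma greedy_policy_average_gap:
  fixes p :: "'s::finite \<Rightarrow> 'a::finite \<Rightarrow> 's pmf"
  assumes erg: "uniformly_ergodic p" and \<gamma>: "0 \<le> \<gamma>" "\<gamma> < 1"
    and ph: "stochastic ph"
    and r: "\<And>s a. 0 \<le> r s a" "\<And>s a. r s a \<le> 1"
    and R: "\<And>s a. r s a \<le> R s a" "\<And>s a. R s a \<le> r s a + \<zeta>" and \<zeta>: "\<zeta> \<le> 1"
    and err: "\<And>s a. \<bar>(\<Sum>s'\<in>UNIV. ph s a s' * disc_value R ph \<gamma> s') - pmean (p s a) (disc_value R ph \<gamma>)\<bar>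
        \<le> (1 - \<gamma>) / 500 * pvar (p s a) (disc_value R ph \<gamma>) + l"
    and l: "l \<le> 3 / 5 * (1 - \<gamma>) * t_minorize p"
    and greedy: "greedy R ph \<gamma> pol"
  shows "0 \<le> opt_avg_reward p r - avg_reward p r pol"
    and "opt_avg_reward p r - avg_reward p r pol \<le> 5 * (1 - \<gamma>) * t_minorize p + \<zeta>"
proof -
  show "0 \<le> opt_avg_reward p r - avg_reward p r pol"
    unfolding opt_avg_reward_def by (simp add: Max_ge)
  have "opt_avg_reward p r \<in> range (avg_reward p r)"
    unfolding opt_avg_reward_def by (rule Max_in) auto
  then obtain pol' where pol': "opt_avg_reward p r = avg_reward p r pol'" by blast
  obtain x where x: "\<And>s. x s = r s (pol s) + \<gamma> * pmean (step p pol s) x"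
    using policy_value_exists[OF \<gamma>, of "\<lambda>s. r s (pol s)" "step p pol"] by blast
  obtain y where y: "\<And>s. y s = r s (pol' s) + \<gamma> * pmean (step p pol' s) y"
    using policy_value_exists[OF \<gamma>, of "\<lambda>s. r s (pol' s)" "step p pol'"] by blast
  let ?s = "undefined :: 's"
  have "y ?s - x ?s \<le> 3 * t_minorize p + \<zeta> / (1 - \<gamma>)"
    by (rule greedy_policy_suboptimality[OF erg \<gamma> ph r R \<zeta> err l greedy x y])
  then have "(1 - \<gamma>) * (y ?s - x ?s) \<le> (1 - \<gamma>) * (3 * t_minorize p + \<zeta> / (1 - \<gamma>))"
    using \<gamma> by (intro mult_left_mono) auto
  also have "\<dots> = 3 * (1 - \<gamma>) * t_minorize p + \<zeta>" using \<gamma> by (simp add: field_simps)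
  finally have gap: "(1 - \<gamma>) * y ?s - (1 - \<gamma>) * x ?s \<le> 3 * (1 - \<gamma>) * t_minorize p + \<zeta>"
    by (simp add: algebra_simps)
  have "\<bar>avg_reward p r pol - (1 - \<gamma>) * x ?s\<bar> \<le> (1 - \<gamma>) * t_minorize p"
    by (rule avg_reward_discounted[where x=x and r=r and pol=pol, OF erg \<gamma> r x])
  moreover have "\<bar>avg_reward p r pol' - (1 - \<gamma>) * y ?s\<bar> \<le> (1 - \<gamma>) * t_minorize p"
    by (rule avg_reward_discounted[where x=y and r=r and pol=pol', OF erg \<gamma> r y])
  ultimately have "avg_reward p r pol' - avg_reward p r pol
      \<le> 3 * ((1 - \<gamma>) * t_minorize p) + \<zeta> + 2 * ((1 - \<gamma>) * t_minorize p)"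
    using gap unfolding abs_le_iff by (simp only: mult.assoc) linarith
  then show "opt_avg_reward p r - avg_reward p r pol \<le> 5 * (1 - \<gamma>) * t_minorize p + \<zeta>"
    unfolding pol' by (simp add: algebra_simps)
qed

section \<open>Concentration of the empirical model\<close>

text \<open>For negative \<open>x\<close>, the product
  \<open>(1 + x + x^2) * (1 - x) = 1 - x^3\<close> is at least 1, and
  \<open>1 - x \<le> exp (- x)\<close>.\<close>

lemma exp_le_quadratic:
  fixes x :: real assumes "\<bar>x\<bar> \<le> 1" shows "exp x \<le> 1 + x + x^2"
proof (cases "0 \<le> x")
  case True then show ?thesis using exp_bound assms by auto
next
  case False
  have "1 \<le> (1 + x + x^2) * (1 - x)"
  proof -
    have "(1 + x + x^2) * (1 - x) = 1 - x * x^2" by (simp add: power2_eq_square algebra_simps)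
    moreover have "x * x^2 \<le> 0" using False by (intro mult_nonpos_nonneg) auto
    ultimately show ?thesis by linarith
  qed
  also have "\<dots> \<le> (1 + x + x^2) * exp (- x)"
  proof (intro mult_left_mono)
    show "1 - x \<le> exp (- x)" using exp_ge_add_one_self[of "- x"] by simp
    show "0 \<le> 1 + x + x^2" using assms zero_le_power2[of x] by linarith
  qed
  finally show ?thesis by (simp add: exp_minus field_simps)
qed

lemma pmean_exp_le:
  assumes "\<And>x. \<bar>\<mu> * (g x - pmean q g)\<bar> \<le> 1"
  shows "pmean q (\<lambda>x. exp (\<mu> * (g x - pmean q g))) \<le> exp (\<mu>^2 * pvar q g)"
proof -
  have "pmean q (\<lambda>x. exp (\<mu> * (g x - pmean q g)))
      \<le> pmean q (\<lambda>x. 1 + (\<mu> * (g x - pmean q g) + \<mu>^2 * (g x - pmean q g)^2))"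
    by (rule pmean_mono) (use exp_le_quadratic[OF assms] in \<open>simp add: power_mult_distrib add.assoc\<close>)
  also have "\<dots> = 1 + \<mu>^2 * pvar q g"
    unfolding pmean_add pmean_cmult pmean_diff pvar_def by simp
  also have "\<dots> \<le> exp (\<mu>^2 * pvar q g)" by (rule exp_ge_add_one_self)
  finally show ?thesis .
qed

text \<open>Chernoff's method with \<mu> kept as a free parameter instead of being optimised. The
  deviation is thus linear in the variance, as \<open>total_variance_bound\<close> requires, rather
  than in its square root.\<close>

lemma bernstein_Pi_pmf:
  fixes q :: "'s::finite pmf" and g :: "'s \<Rightarrow> real"
  assumes I: "finite I" and P: "\<And>i. i \<in> I \<Longrightarrow> P i = q"
    and \<mu>: "0 < \<mu>" "\<And>x. \<bar>\<mu> * (g x - pmean q g)\<bar> \<le> 1"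
  shows "measure_pmf.prob (Pi_pmf I d P)
      {f. real (card I) * (pmean q g + \<mu> * pvar q g) + L / \<mu> \<le> (\<Sum>i\<in>I. g (f i))} \<le> exp (- L)"
proof -
  define Y where "Y f = (\<Prod>i\<in>I. exp (\<mu> * (g (f i) - pmean q g)))" for f
  have "measure_pmf.expectation (Pi_pmf I d P) Y
      = (\<Prod>i\<in>I. measure_pmf.expectation (P i) (\<lambda>x. exp (\<mu> * (g x - pmean q g))))"
    unfolding Y_def
    by (rule expectation_prod_Pi_pmf[OF I]) (auto intro: integrable_measure_pmf_finite)
  also have "\<dots> = (pmean q (\<lambda>x. exp (\<mu> * (g x - pmean q g)))) ^ card I"
    by (simp add: P expectation_eq_pmean)
  also have "\<dots> \<le> exp (\<mu>^2 * pvar q g) ^ card I"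
    by (intro power_mono pmean_exp_le \<mu> pmean_ge) auto
  finally have EY: "measure_pmf.expectation (Pi_pmf I d P) Y \<le> exp (real (card I) * (\<mu>^2 * pvar q g))"
    by (simp add: exp_of_nat_mult)
  \<comment> \<open>The threshold is the moment bound times \<open>exp L\<close>, so Markov's
    inequality leaves exactly \<open>exp (- L)\<close>.\<close>
  define c where "c = exp (real (card I) * (\<mu>^2 * pvar q g) + L)"
  have Yexp: "Y f = exp (\<mu> * ((\<Sum>i\<in>I. g (f i)) - real (card I) * pmean q g))" for f
    unfolding Y_def exp_sum[OF I, symmetric] by (simp add: sum_distrib_left[symmetric] sum_subtractf)
  have fin: "finite (set_pmf (Pi_pmf I d P))"
    unfolding set_Pi_pmf[OF I] by (rule finite_PiE_dflt) (use I in auto)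
  have "measure_pmf.prob (Pi_pmf I d P) {f \<in> space (measure_pmf (Pi_pmf I d P)). c \<le> Y f}
      \<le> measure_pmf.expectation (Pi_pmf I d P) Y / c"
    by (rule integral_Markov_inequality_measure[where A="{}"])
       (use fin in \<open>auto simp: c_def Yexp intro: integrable_measure_pmf_finite\<close>)
  also have "\<dots> \<le> exp (real (card I) * (\<mu>^2 * pvar q g)) / c"
    using EY by (intro divide_right_mono) (auto simp: c_def)
  also have "\<dots> = exp (- L)" by (simp add: c_def exp_add exp_minus field_simps)
  finally have "measure_pmf.prob (Pi_pmf I d P) {f. c \<le> Y f} \<le> exp (- L)" by simp
  moreover have "c \<le> Y f \<longleftrightarrow>
      real (card I) * (pmean q g + \<mu> * pvar q g) + L / \<mu> \<le> (\<Sum>i\<in>I. g (f i))" for f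
  proof -
    have "c \<le> Y f \<longleftrightarrow> \<mu> * (real (card I) * (pmean q g + \<mu> * pvar q g) + L / \<mu>)
        \<le> \<mu> * (\<Sum>i\<in>I. g (f i))"
      unfolding c_def Yexp using \<mu>(1) by (simp add: algebra_simps power2_eq_square)
    then show ?thesis using \<mu>(1) by simp
  qed
  ultimately show ?thesis by simp
qed

lemma bernstein_Pi_pmf_abs:
  fixes q :: "'s::finite pmf" and g :: "'s \<Rightarrow> real"
  assumes I: "finite I" "I \<noteq> {}" and P: "\<And>i. i \<in> I \<Longrightarrow> P i = q"
    and \<mu>: "0 < \<mu>" "\<And>x. \<bar>\<mu> * (g x - pmean q g)\<bar> \<le> 1"
  shows "measure_pmf.prob (Pi_pmf I d P)
      {f. \<mu> * pvar q g + L / (real (card I) * \<mu>)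
          < \<bar>(\<Sum>i\<in>I. g (f i)) / real (card I) - pmean q g\<bar>} \<le> 2 * exp (- L)"
proof -
  let ?n = "real (card I)"
  let ?A = "\<lambda>g. {f. ?n * (pmean q g + \<mu> * pvar q g) + L / \<mu> \<le> (\<Sum>i\<in>I. g (f i))}"
  have n: "0 < ?n" using I by (simp add: card_gt_0_iff)
  have neg: "pvar q (\<lambda>x. - g x) = pvar q g"
    by (simp add: pvar_def pmean_uminus power2_commute)
  have "{f. \<mu> * pvar q g + L / (?n * \<mu>) < \<bar>(\<Sum>i\<in>I. g (f i)) / ?n - pmean q g\<bar>}
      \<subseteq> ?A g \<union> ?A (\<lambda>x. - g x)"
  proof
    fix f assume "f \<in> {f. \<mu> * pvar q g + L / (?n * \<mu>) < \<bar>(\<Sum>i\<in>I. g (f i)) / ?n - pmean q g\<bar>}"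
    then have "?n * (\<mu> * pvar q g + L / (?n * \<mu>)) \<le> ?n * \<bar>(\<Sum>i\<in>I. g (f i)) / ?n - pmean q g\<bar>"
      using n by (intro mult_left_mono) auto
    also have "\<dots> = \<bar>(\<Sum>i\<in>I. g (f i)) - ?n * pmean q g\<bar>"
    proof -
      have "(\<Sum>i\<in>I. g (f i)) - ?n * pmean q g = ?n * ((\<Sum>i\<in>I. g (f i)) / ?n - pmean q g)"
        using n by (simp add: right_diff_distrib)
      then show ?thesis using n by (simp add: abs_mult)
    qed
    also have "?n * (\<mu> * pvar q g + L / (?n * \<mu>)) = ?n * (\<mu> * pvar q g) + L / \<mu>"
      using n \<mu>(1) by (simp add: field_simps)
    finally show "f \<in> ?A g \<union> ?A (\<lambda>x. - g x)"
      by (auto simp: neg pmean_uminus sum_negf algebra_simps)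
  qed
  then have "measure_pmf.prob (Pi_pmf I d P)
        {f. \<mu> * pvar q g + L / (?n * \<mu>) < \<bar>(\<Sum>i\<in>I. g (f i)) / ?n - pmean q g\<bar>}
      \<le> measure_pmf.prob (Pi_pmf I d P) (?A g) + measure_pmf.prob (Pi_pmf I d P) (?A (\<lambda>x. - g x))"
    by (intro order_trans[OF measure_pmf.finite_measure_mono measure_Un_le]) auto
  also have "measure_pmf.prob (Pi_pmf I d P) (?A g) \<le> exp (- L)"
    by (rule bernstein_Pi_pmf[OF I(1) P \<mu>])
  also have "measure_pmf.prob (Pi_pmf I d P) (?A (\<lambda>x. - g x)) \<le> exp (- L)"
  proof (rule bernstein_Pi_pmf[OF I(1) P \<mu>(1)])
    show "\<bar>\<mu> * (- g x - pmean q (\<lambda>x. - g x))\<bar> \<le> 1" for x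
      using \<mu>(2)[of x] by (simp add: pmean_uminus abs_mult abs_minus_commute)
  qed
  finally show ?thesis by simp
qed

section \<open>Empirical kernels and leave-one-out conditioning\<close>

lemma prob_bind_pmf_le:
  assumes "\<And>x. measure_pmf.prob (K x) A \<le> c"
  shows "measure_pmf.prob (bind_pmf q K) A \<le> c"
proof -
  have c: "0 \<le> c" using assms[of undefined] measure_nonneg order_trans by blast
  have "emeasure (measure_pmf (bind_pmf q K)) A = (\<integral>\<^sup>+x. emeasure (measure_pmf (K x)) A \<partial>measure_pmf q)"
    by simp
  also have "\<dots> \<le> (\<integral>\<^sup>+x. ennreal c \<partial>measure_pmf q)"
    by (rule nn_integral_mono) (simp add: measure_pmf.emeasure_eq_measure assms ennreal_leI)
  also have "\<dots> = ennreal c" by simp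
  finally show ?thesis using c by (simp add: measure_pmf.emeasure_eq_measure)
qed

abbreviation sample_pmf :: "('s \<Rightarrow> 'a \<Rightarrow> 's pmf) \<Rightarrow> nat \<Rightarrow> ('s \<times> 'a \<times> nat \<Rightarrow> 's) pmf" where
  "sample_pmf p n \<equiv> Pi_pmf {(s, a, i). i < n} undefined (\<lambda>(s, a, i). p s a)"

lemma sum_phat:
  "(\<Sum>s'\<in>UNIV. phat n X s a s' * v s') = (\<Sum>i<n. v (X (s, a, i))) / real n" for v :: "'s::finite \<Rightarrow> real"
proof -
  have "(\<Sum>i<n. v (X (s, a, i))) = (\<Sum>s'\<in>UNIV. \<Sum>i\<in>{i\<in>{..<n}. X (s, a, i) = s'}. v (X (s, a, i)))"
    by (rule sum.group[symmetric]) auto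
  also have "\<dots> = (\<Sum>s'\<in>UNIV. real (card {i \<in> {..<n}. X (s, a, i) = s'}) * v s')"
    by (intro sum.cong) auto
  finally show ?thesis by (simp add: phat_def sum_divide_distrib)
qed

lemma stochastic_phat: "0 < n \<Longrightarrow> stochastic (phat n X)"
  unfolding stochastic_def using sum_phat[of n X _ _ "\<lambda>_. 1"] by (auto simp: phat_def)

text \<open>The absorbing value at \<open>s\<close> only depends on samples from other states, hence
  is independent of the samples from \<open>(s, a)\<close>.\<close>

lemma absorb_concentration:
  fixes p :: "'s::finite \<Rightarrow> 'a::finite \<Rightarrow> 's pmf"
  assumes n: "0 < n" and \<gamma>: "0 \<le> \<gamma>" "\<gamma> < 1"
    and R: "\<And>s a. 0 \<le> R s a" "\<And>s a. R s a \<le> b"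
    and u: "0 \<le> u" "u \<le> b / (1 - \<gamma>)"
    and \<mu>: "0 < \<mu>" "\<mu> * (b / (1 - \<gamma>)) \<le> 1"
  shows "measure_pmf.prob (sample_pmf p n)
      {X. \<mu> * pvar (p s a) (absorb_value R (phat n X) \<gamma> s u) + L / (real n * \<mu>)
          < \<bar>(\<Sum>s'\<in>UNIV. phat n X s a s' * absorb_value R (phat n X) \<gamma> s u s')
             - pmean (p s a) (absorb_value R (phat n X) \<gamma> s u)\<bar>} \<le> 2 * exp (- L)"
proof -
  define P where "P = (\<lambda>(s, a, i :: nat). p s a)"
  define A where "A = (\<lambda>i. (s, a, i)) ` {..<n}"
  define B where "B = {(s' :: 's, a' :: 'a, i). i < n} - A"
  have D: "{(s' :: 's, a' :: 'a, i). i < n} = A \<union> B" by (auto simp: A_def B_def)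
  have "{(s' :: 's, a' :: 'a, i). i < n} = UNIV \<times> UNIV \<times> {..<n}" by auto
  then have fin: "finite A" "finite B" by (auto simp: A_def B_def)
  have inj: "inj_on (\<lambda>i. (s, a, i)) {..<n}" by (auto simp: inj_on_def)
  have card: "card A = n" unfolding A_def by (simp add: card_image[OF inj])
  have sumA: "(\<Sum>k\<in>A. f k) = (\<Sum>i<n. f (s, a, i))" for f :: "_ \<Rightarrow> real"
    unfolding A_def by (simp add: sum.reindex[OF inj])
  define v where "v X = absorb_value R (phat n X) \<gamma> s u" for X
  define mix where "mix f g = (\<lambda>x. if x \<in> A then f x else g x)" for f g :: "'s \<times> 'a \<times> nat \<Rightarrow> 's"
  \<comment> \<open>Changing the samples in \<open>A\<close> alters only the row at
    \<open>s\<close>, which the absorbing model ignores.\<close>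
  have v_mix: "v (mix f g) = v g" for f g
    unfolding v_def
  proof (rule absorb_value_cong)
    fix s1 a1 s' assume "s1 \<noteq> s"
    then have "mix f g (s1, a1, i) = g (s1, a1, i)" for i by (auto simp: mix_def A_def)
    then show "phat n (mix f g) s1 a1 s' = phat n g s1 a1 s'" by (simp add: phat_def)
  qed
  have "measure_pmf.prob (Pi_pmf A undefined P)
      {f. \<mu> * pvar (p s a) (v g) + L / (real n * \<mu>)
          < \<bar>(\<Sum>s'\<in>UNIV. phat n (mix f g) s a s' * v g s') - pmean (p s a) (v g)\<bar>} \<le> 2 * exp (- L)"
    (is "measure_pmf.prob _ ?bad \<le> _") for g
  proof -
    have rng: "0 \<le> v g x" "v g x \<le> b / (1 - \<gamma>)" for x
      using absorb_value_range[where R=R and s=x, OF stochastic_phat[OF n] \<gamma> R u] by (auto simp: v_def)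
    have "\<bar>v g x - pmean (p s a) (v g)\<bar> \<le> b / (1 - \<gamma>)" for x
      using rng[of x] pmean_le[of "v g", OF rng(2), of "p s a"] pmean_ge[of 0 "v g", OF rng(1), of "p s a"]
      by linarith
    then have "\<mu> * \<bar>v g x - pmean (p s a) (v g)\<bar> \<le> \<mu> * (b / (1 - \<gamma>))" for x
      using \<mu>(1) by (intro mult_left_mono) auto
    then have "\<mu> * \<bar>v g x - pmean (p s a) (v g)\<bar> \<le> 1" for x
      using \<mu>(2) order_trans by blast
    then have dev: "\<bar>\<mu> * (v g x - pmean (p s a) (v g))\<bar> \<le> 1" for x
      using \<mu>(1) by (simp add: abs_mult)
    have "?bad = {f. \<mu> * pvar (p s a) (v g) + L / (real (card A) * \<mu>)
        < \<bar>(\<Sum>k\<in>A. v g (f k)) / real (card A) - pmean (p s a) (v g)\<bar>}"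
      unfolding sum_phat card sumA by (simp add: mix_def A_def)
    then show ?thesis
      using bernstein_Pi_pmf_abs[of A P "p s a" \<mu> "v g", OF fin(1) _ _ \<mu>(1) dev] n
      by (auto simp: A_def P_def)
  qed
  then have row: "measure_pmf.prob (map_pmf (\<lambda>f. mix f g) (Pi_pmf A undefined P))
      {X. \<mu> * pvar (p s a) (v X) + L / (real n * \<mu>)
          < \<bar>(\<Sum>s'\<in>UNIV. phat n X s a s' * v X s') - pmean (p s a) (v X)\<bar>} \<le> 2 * exp (- L)" for g
    by (simp add: vimage_def v_mix)
  \<comment> \<open>The samples outside \<open>A\<close> are drawn first. Given them, the absorbing
    value is a fixed function and the samples in \<open>A\<close> are still independent, so the
    Bernstein bound applies conditionally.\<close>
  have "sample_pmf p n = map_pmf (\<lambda>(f, g). mix f g)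
      (pair_pmf (Pi_pmf A undefined P) (Pi_pmf B undefined P))"
    unfolding D P_def[symmetric] mix_def by (rule Pi_pmf_union) (use fin in \<open>auto simp: B_def\<close>)
  also have "\<dots> = bind_pmf (Pi_pmf B undefined P)
      (\<lambda>g. map_pmf (\<lambda>f. mix f g) (Pi_pmf A undefined P))"
    unfolding pair_pmf_def map_bind_pmf
    by (subst bind_commute_pmf) (simp add: map_pmf_def bind_return_pmf bind_assoc_pmf)
  finally show ?thesis
    unfolding v_def[symmetric] using prob_bind_pmf_le[OF row] by simp
qed

text \<open>Nearby absorbing values \<open>j * \<eta>\<close> stand in for the data-dependent value
  \<open>disc_value R ph \<gamma> s\<close>, at which the absorbing model reproduces \<open>disc_value R ph \<gamma>\<close>.\<close>

lemma net_concentration_transfer: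
  fixes p :: "'s::finite \<Rightarrow> 'a::finite \<Rightarrow> 's pmf"
  assumes ph: "stochastic ph" and \<gamma>: "0 \<le> \<gamma>" "\<gamma> < 1"
    and \<eta>: "0 < \<eta>" and \<mu>: "0 \<le> \<mu>"
    and range: "0 \<le> disc_value R ph \<gamma> s" "disc_value R ph \<gamma> s \<le> real J * \<eta>"
    and net: "\<And>j. j \<le> J \<Longrightarrow>
        \<bar>(\<Sum>s'\<in>UNIV. ph s a s' * absorb_value R ph \<gamma> s (real j * \<eta>) s')
          - pmean (p s a) (absorb_value R ph \<gamma> s (real j * \<eta>))\<bar>
        \<le> \<mu> * pvar (p s a) (absorb_value R ph \<gamma> s (real j * \<eta>)) + l"
  shows "\<bar>(\<Sum>s'\<in>UNIV. ph s a s' * disc_value R ph \<gamma> s') - pmean (p s a) (disc_value R ph \<gamma>)\<bar>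
      \<le> 2 * \<mu> * pvar (p s a) (disc_value R ph \<gamma>) + (l + 2 * \<eta> + 2 * \<mu> * \<eta>^2)"
proof -
  define v where "v = disc_value R ph \<gamma>"
  \<comment> \<open>The optimal value at \<open>s\<close> is rounded down to the net, at a distance
    of at most \<eta>.\<close>
  define j where "j = nat \<lfloor>v s / \<eta>\<rfloor>"
  define w where "w = absorb_value R ph \<gamma> s (real j * \<eta>)"
  have vs: "0 \<le> v s / \<eta>" "v s / \<eta> \<le> real J" using range \<eta> by (auto simp: v_def pos_divide_le_eq)
  then have j: "real j \<le> v s / \<eta>" "v s / \<eta> < real j + 1" unfolding j_def by linarith+
  then have "j \<le> J" using vs by linarith
  have "real j * \<eta> \<le> v s" "v s \<le> real j * \<eta> + \<eta>"
    using j \<eta> by (auto simp: pos_le_divide_eq pos_divide_less_eq algebra_simps)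
  then have "\<bar>v s - real j * \<eta>\<bar> \<le> \<eta>" by (auto simp: abs_le_iff)
  moreover have "v = absorb_value R ph \<gamma> s (v s)"
    unfolding v_def by (rule absorb_value_at_optimum[OF ph \<gamma>, symmetric])
  ultimately have vw: "\<bar>v x - w x\<bar> \<le> \<eta>" for x
    using absorb_value_lipschitz[OF ph \<gamma>, of R s "v s" x "real j * \<eta>"] unfolding w_def
    by (metis order_trans)
  have wv: "\<bar>w x - v x\<bar> \<le> \<eta>" for x using vw[of x] by linarith
  \<comment> \<open>The variance contributes \<open>2 * \<mu> * \<eta>^2\<close>; exchanging
    \<open>w\<close> for \<open>v\<close> under the empirical and under the true row costs \<eta>
    each.\<close>
  have "\<mu> * pvar (p s a) w \<le> \<mu> * (2 * pvar (p s a) v + 2 * \<eta>^2)"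
    using \<mu> by (intro mult_left_mono pvar_perturb wv)
  moreover note net[OF \<open>j \<le> J\<close>, folded w_def] stochastic_row_abs_diff_le[of ph v w \<eta> s a, OF ph vw]
    pmean_abs_diff_le[of v w \<eta> "p s a", OF vw]
  ultimately show ?thesis unfolding v_def[symmetric] by (simp add: algebra_simps abs_le_iff)
qed

text \<open>A union bound over all pairs and net points. The rewards are fixed here; the
  perturbation enters later, one realisation at a time.\<close>

lemma net_concentration:
  fixes p :: "'s::finite \<Rightarrow> 'a::finite \<Rightarrow> 's pmf"
  assumes n: "0 < n" and \<gamma>: "0 \<le> \<gamma>" "\<gamma> < 1"
    and R: "\<And>s a. 0 \<le> R s a" "\<And>s a. R s a \<le> b"
    and \<eta>: "0 \<le> \<eta>" "real J * \<eta> \<le> b / (1 - \<gamma>)"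
    and \<mu>: "0 < \<mu>" "\<mu> * (b / (1 - \<gamma>)) \<le> 1"
  shows "1 - real (CARD('s) * CARD('a) * (J + 1)) * (2 * exp (- L)) \<le> measure_pmf.prob (sample_pmf p n)
      {X. \<forall>s a. \<forall>j\<le>J. \<bar>(\<Sum>s'\<in>UNIV. phat n X s a s' * absorb_value R (phat n X) \<gamma> s (real j * \<eta>) s')
             - pmean (p s a) (absorb_value R (phat n X) \<gamma> s (real j * \<eta>))\<bar>
          \<le> \<mu> * pvar (p s a) (absorb_value R (phat n X) \<gamma> s (real j * \<eta>)) + L / (real n * \<mu>)}"
    (is "_ \<le> measure_pmf.prob _ ?G")
proof -
  define F where "F = (\<lambda>(s, a, j). {X.
      \<mu> * pvar (p s a) (absorb_value R (phat n X) \<gamma> s (real j * \<eta>)) + L / (real n * \<mu>)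
      < \<bar>(\<Sum>s'\<in>UNIV. phat n X s a s' * absorb_value R (phat n X) \<gamma> s (real j * \<eta>) s')
             - pmean (p s a) (absorb_value R (phat n X) \<gamma> s (real j * \<eta>))\<bar>})"
  let ?I = "(UNIV :: 's set) \<times> (UNIV :: 'a set) \<times> {..J}"
  have card: "card ?I = CARD('s) * CARD('a) * (J + 1)" by (simp add: card_cartesian_product algebra_simps)
  have G: "?G = - (\<Union>k\<in>?I. F k)"
    unfolding F_def set_eq_iff Compl_iff UN_iff mem_Collect_eq
    by (simp add: Bex_def not_less split_paired_All)
  have "measure_pmf.prob (sample_pmf p n) (\<Union>k\<in>?I. F k)
      \<le> (\<Sum>k\<in>?I. measure_pmf.prob (sample_pmf p n) (F k))"
    by (rule measure_UNION_le) auto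
  also have "\<dots> \<le> (\<Sum>k\<in>?I. 2 * exp (- L))"
  proof (rule sum_mono)
    fix k assume "k \<in> ?I"
    then obtain s a j where k: "k = (s, a, j)" "j \<le> J" by auto
    have "real j * \<eta> \<le> real J * \<eta>" using k \<eta> by (intro mult_right_mono) auto
    then have "real j * \<eta> \<le> b / (1 - \<gamma>)" using \<eta> by linarith
    then show "measure_pmf.prob (sample_pmf p n) (F k) \<le> 2 * exp (- L)"
      unfolding k F_def prod.case using \<eta> by (intro absorb_concentration[OF n \<gamma> R _ _ \<mu>]) auto
  qed
  also have "\<dots> = real (CARD('s) * CARD('a) * (J + 1)) * (2 * exp (- L))"
    by (simp only: sum_constant card)
  finally show ?thesis
    unfolding G using measure_pmf.prob_compl[of "\<Union>k\<in>?I. F k" "sample_pmf p n"]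
    by (simp add: Compl_eq_Diff_UNIV)
qed

section \<open>Measurability\<close>

lemma bellman_iterate_measurable:
  fixes R :: "'w \<Rightarrow> 's::finite \<Rightarrow> 'a::finite \<Rightarrow> real"
  assumes R [measurable]: "\<And>s a. (\<lambda>\<omega>. R \<omega> s a) \<in> borel_measurable M"
  shows "(\<lambda>\<omega>. ((bellman_op (R \<omega>) ph \<gamma>) ^^ k) (\<lambda>_. 0) s) \<in> borel_measurable M"
proof (induction k arbitrary: s)
  case 0 then show ?case by simp
next
  case (Suc k)
  note [measurable] = Suc.IH
  have "(\<lambda>\<omega>. bellman (R \<omega>) ph \<gamma> ((bellman_op (R \<omega>) ph \<gamma> ^^ k) (\<lambda>_. 0)) s a) \<in> borel_measurable M" for a
    unfolding bellman_def by measurable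
  then have "(\<lambda>\<omega>. bellman_op (R \<omega>) ph \<gamma> ((bellman_op (R \<omega>) ph \<gamma> ^^ k) (\<lambda>_. 0)) s) \<in> borel_measurable M"
    unfolding bellman_op_def by (intro borel_measurable_Max) auto
  then show ?case by simp
qed

text \<open>The description by \<open>THE\<close> says nothing about measurability, but value
  iteration exhibits the optimal value as a pointwise limit of measurable functions.\<close>

lemma disc_value_measurable:
  fixes R :: "'w \<Rightarrow> 's::finite \<Rightarrow> 'a::finite \<Rightarrow> real"
  assumes R: "\<And>s a. (\<lambda>\<omega>. R \<omega> s a) \<in> borel_measurable M"
    and ph: "stochastic ph" and \<gamma>: "0 \<le> \<gamma>" "\<gamma> < 1"
  shows "(\<lambda>\<omega>. disc_value (R \<omega>) ph \<gamma> s) \<in> borel_measurable M"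
proof (rule borel_measurable_LIMSEQ_real)
  show "(\<lambda>k. ((bellman_op (R \<omega>) ph \<gamma>) ^^ k) (\<lambda>_. 0) s) \<longlonglongrightarrow> disc_value (R \<omega>) ph \<gamma> s" for \<omega>
    unfolding disc_value_THE by (rule the_fixpoint(3)[OF contraction_bellman_op[OF ph \<gamma>(1)] \<gamma>])
qed (rule bellman_iterate_measurable[OF R])

lemma greedy_measurable:
  fixes R :: "'w \<Rightarrow> 's::finite \<Rightarrow> 'a::finite \<Rightarrow> real"
  assumes R [measurable]: "\<And>s a. (\<lambda>\<omega>. R \<omega> s a) \<in> borel_measurable M"
    and ph: "stochastic ph" and \<gamma>: "0 \<le> \<gamma>" "\<gamma> < 1"
  shows "{\<omega> \<in> space M. greedy (R \<omega>) ph \<gamma> pol} \<in> sets M"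
proof -
  note [measurable] = disc_value_measurable[OF R ph \<gamma>]
  show ?thesis unfolding greedy_def bellman_def by measurable
qed

lemma countable_range_phat: "countable (range (phat n :: ('s::finite \<times> 'a::finite \<times> nat \<Rightarrow> 's) \<Rightarrow> _))"
proof -
  have "range (phat n :: ('s \<times> 'a \<times> nat \<Rightarrow> 's) \<Rightarrow> _)
      \<subseteq> range (\<lambda>(c :: 's \<Rightarrow> 'a \<Rightarrow> 's \<Rightarrow> nat) s a s'. real (c s a s') / real n)"
    by (auto simp: phat_def[abs_def] image_iff)
  then show ?thesis by (rule countable_subset) simp
qed

lemma prob_space_perturbation:
  assumes "0 < \<zeta>" shows "prob_space (uniform_measure lborel {0<..<\<zeta> :: real})"
  using assms by (intro prob_space_uniform_measure) auto

text \<open>The event is split over the countably many empirical kernels. For a fixed kernel,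
  greediness is a measurable condition on the perturbation, and the kernel event concerns the
  discrete samples alone.\<close>

lemma pmbp_output_measurable:
  fixes p :: "'s::finite \<Rightarrow> 'a::finite \<Rightarrow> 's pmf"
  assumes n: "0 < n" and \<gamma>: "0 \<le> \<gamma>" "\<gamma> < 1"
  shows "{\<omega> \<in> space (pmbp_space p \<zeta> n). pmbp_output r \<gamma> n \<omega> pol} \<in> sets (pmbp_space p \<zeta> n)"
proof -
  let ?M = "pmbp_space p \<zeta> n"
  let ?H = "range (phat n) :: ('s \<Rightarrow> 'a \<Rightarrow> 's \<Rightarrow> real) set"
  have fst_meas: "(\<lambda>\<omega>. fst \<omega> k) \<in> borel_measurable ?M" for k
  proof -
    have "(\<lambda>Z. Z k) \<in> measurable (PiM UNIV (\<lambda>_. uniform_measure lborel {0<..<\<zeta>})) (uniform_measure lborel {0<..<\<zeta>})"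
      by (rule measurable_component_singleton) simp
    then have "(\<lambda>Z. Z k) \<in> borel_measurable (PiM UNIV (\<lambda>_. uniform_measure lborel {0<..<\<zeta>}))"
      by (simp cong: measurable_cong_sets)
    then show ?thesis unfolding pmbp_space_def by (rule measurable_compose[OF measurable_fst])
  qed
  have snd_meas: "snd \<in> measurable ?M (measure_pmf (sample_pmf p n))"
    unfolding pmbp_space_def by (rule measurable_snd)
  have "{\<omega> \<in> space ?M. pmbp_output r \<gamma> n \<omega> pol} = (\<Union>h\<in>?H.
      {\<omega> \<in> space ?M. greedy (\<lambda>s a. r s a + fst \<omega> (s, a)) h \<gamma> pol} \<inter> (snd -` {X. phat n X = h} \<inter> space ?M))"
    by (auto simp: pmbp_output_def)
  also have "\<dots> \<in> sets ?M"
  proof (rule sets.countable_UN''[OF countable_range_phat], rule sets.Int)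
    fix h assume "h \<in> ?H"
    then have h: "stochastic h" using stochastic_phat[OF n] by auto
    show "{\<omega> \<in> space ?M. greedy (\<lambda>s a. r s a + fst \<omega> (s, a)) h \<gamma> pol} \<in> sets ?M"
      by (intro greedy_measurable[OF _ h \<gamma>] borel_measurable_add borel_measurable_const fst_meas)
    show "snd -` {X. phat n X = h} \<inter> space ?M \<in> sets ?M"
      by (rule measurable_sets[OF snd_meas]) simp
  qed
  finally show ?thesis .
qed

text \<open>Fubini: a bound on the sample probability for each perturbation in the open box, which
  has full measure, integrates to a bound on the product space.\<close>

lemma pmbp_space_prob_ge:
  fixes p :: "'s::finite \<Rightarrow> 'a::finite \<Rightarrow> 's pmf"
  assumes A: "A \<in> sets (pmbp_space p \<zeta> n)" and \<zeta>: "0 < \<zeta>" and c: "0 \<le> c"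
    and fibre: "\<And>Z. (\<And>k. 0 < Z k \<and> Z k < \<zeta>) \<Longrightarrow> c \<le> measure_pmf.prob (sample_pmf p n) (Pair Z -` A)"
  shows "c \<le> measure (pmbp_space p \<zeta> n) A"
proof -
  define U where "U = uniform_measure lborel {0<..<\<zeta> :: real}"
  define N where "N = PiM (UNIV :: ('s \<times> 'a) set) (\<lambda>_. U)"
  have U: "prob_space U" unfolding U_def by (rule prob_space_perturbation[OF \<zeta>])
  have M: "pmbp_space p \<zeta> n = N \<Otimes>\<^sub>M measure_pmf (sample_pmf p n)"
    by (simp add: pmbp_space_def N_def U_def)
  interpret N: prob_space N unfolding N_def by (rule prob_space_PiM[OF U])
  interpret NP: pair_prob_space N "measure_pmf (sample_pmf p n)" ..
  have "AE x in U. 0 < x \<and> x < \<zeta>" unfolding U_def by (rule AE_uniform_measureI) auto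
  then have "AE Z in N. 0 < Z k \<and> Z k < \<zeta>" for k
    unfolding N_def by (rule AE_PiM_component[OF U UNIV_I])
  then have ae: "AE Z in N. \<forall>k. 0 < Z k \<and> Z k < \<zeta>" by (simp add: AE_all_countable)
  have "ennreal c = (\<integral>\<^sup>+Z. ennreal c \<partial>N)" by (simp add: N.emeasure_space_1)
  also have "\<dots> \<le> (\<integral>\<^sup>+Z. emeasure (measure_pmf (sample_pmf p n)) (Pair Z -` A) \<partial>N)"
    by (rule nn_integral_mono_AE)
       (use ae fibre in \<open>auto simp: measure_pmf.emeasure_eq_measure ennreal_leI elim!: eventually_mono\<close>)
  also have "\<dots> = emeasure (pmbp_space p \<zeta> n) A"
    using A unfolding M by (rule measure_pmf.emeasure_pair_measure_alt[symmetric])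
  also have "\<dots> = ennreal (measure (pmbp_space p \<zeta> n) A)"
    unfolding M by (rule NP.P.emeasure_eq_measure)
  finally show ?thesis using c by (simp add: ennreal_le_iff)
qed

section \<open>Choice of parameters\<close>

text \<open>The first bound says that \<beta> covers the logarithm demanded by the union bound over
  the net; the last one justifies the sample complexity.\<close>

lemma beta_delta_bounds:
  fixes nS nA :: nat and t \<epsilon> \<delta> \<gamma> \<zeta> :: real
  assumes S: "1 \<le> nS" "1 \<le> nA" and t: "1 \<le> t" and \<epsilon>: "0 < \<epsilon>" "\<epsilon> \<le> 1" and \<delta>: "0 < \<delta>" "\<delta> < 1"
    and \<gamma>: "\<gamma> = 1 - \<epsilon> / (19 * t)" and \<zeta>: "\<zeta> = (1 - \<gamma>) * t / 4"
  defines "\<beta> \<equiv> beta_delta nS nA \<gamma> \<delta> (eta_star nS nA \<gamma> \<zeta> \<delta>)"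
  shows "ln (18 * (real nS * real nA) / ((1 - \<gamma>)^2 * \<delta>)) \<le> \<beta>"
    and "0 < \<beta>"
    and "\<beta> \<le> 64 * (1 + ln (real nS * real nA * t / (\<epsilon> * \<delta>)))"
proof -
  define N where "N = real nS * real nA"
  define D where "D = \<epsilon> / (19 * t)"
  define \<eta> where "\<eta> = eta_star nS nA \<gamma> \<zeta> \<delta>"
  define y where "y = 18 * N / (D^2 * \<delta>)"
  define arg where "arg = 24 * N * log 2 (1 / D) / (D^2 * \<eta> * \<delta>)"
  define x where "x = N * t / (\<epsilon> * \<delta>)"
  have D\<gamma>: "1 - \<gamma> = D" by (simp add: \<gamma> D_def)
  have \<beta>: "\<beta> = 2 * ln arg"
    by (simp add: \<beta>_def beta_delta_def D\<gamma> \<eta>_def[symmetric] arg_def N_def mult.assoc)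
  have S1: "1 \<le> real nS" "1 \<le> real nA" using S by auto
  have N: "1 \<le> N" unfolding N_def using mult_mono[OF S1] by simp
  have D: "0 < D" "D \<le> 1 / 19" unfolding D_def using \<epsilon> t by (auto simp: field_simps)
  have \<zeta>D: "\<zeta> = \<epsilon> / 76" unfolding \<zeta> D\<gamma> D_def using t by (simp add: field_simps)
  have \<eta>: "\<eta> = \<zeta> * \<delta> * D / (9 * (real nS * (real nA)^2))"
    by (simp add: \<eta>_def eta_star_def D\<gamma> mult.assoc)
  have \<eta>0: "0 < \<eta>" unfolding \<eta> \<zeta>D using \<epsilon> \<delta> D S1 by simp
  have \<eta>1: "\<eta> \<le> 1"
  proof -
    have "\<zeta> * \<delta> * D \<le> 1 * 1 * 1" unfolding \<zeta>D using \<epsilon> \<delta> D by (intro mult_mono) auto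
    moreover have "1 \<le> real nS * (real nA)^2"
      using mult_mono[of 1 "real nS" 1 "(real nA)^2"] S1 by (simp add: one_le_power)
    ultimately show ?thesis unfolding \<eta> by (simp add: divide_le_eq)
  qed
  have log1: "1 \<le> log 2 (1 / D)"
    using D by (subst le_log_iff) (auto simp: field_simps)
  have y19: "18 < y"
  proof -
    have "D^2 * \<delta> \<le> 1 * \<delta>" using D \<delta> by (intro mult_right_mono power_le_one) auto
    then have "D^2 * \<delta> < 1" using \<delta> by linarith
    moreover have "0 < D^2 * \<delta>" using D \<delta> by simp
    ultimately show ?thesis unfolding y_def using N by (simp add: less_divide_eq)
  qed
  have yarg: "y \<le> arg"
  proof -
    have "18 * N \<le> 24 * N * log 2 (1 / D)" using mult_mono[of "18 * N" "24 * N" 1 "log 2 (1 / D)"] N log1 by simp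
    moreover have "D^2 * \<eta> * \<delta> \<le> D^2 * \<delta>"
      using mult_left_mono[OF \<eta>1, of "D^2 * \<delta>"] \<delta> by (simp add: mult_ac)
    ultimately show ?thesis unfolding y_def arg_def
      using D \<delta> \<eta>0 N by (intro frac_le) (auto intro: order_trans[of 0 "18 * N"])
  qed
  \<comment> \<open>Positivity makes the factor 2 in \<beta> harmless:
    \<open>2 * ln arg \<ge> ln arg \<ge> ln y\<close>.\<close>
  have lny: "0 < ln y" using y19 by simp
  have lnarg: "ln y \<le> ln arg" using yarg y19 by simp
  show "0 < \<beta>" using \<beta> lny lnarg by simp
  show "ln (18 * (real nS * real nA) / ((1 - \<gamma>)^2 * \<delta>)) \<le> \<beta>"
    using lny lnarg unfolding \<beta> D\<gamma> N_def[symmetric] y_def[symmetric] by linarith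
  have x1: "1 \<le> x"
  proof -
    have "\<epsilon> * \<delta> \<le> 1 * 1" using \<epsilon> \<delta> by (intro mult_mono) auto
    moreover have "1 * 1 \<le> N * t" using N t by (intro mult_mono) auto
    ultimately show ?thesis unfolding x_def using \<epsilon> \<delta> by (simp add: pos_le_divide_eq)
  qed
  have "log 2 (1 / D) \<le> 2 / D"
  proof -
    have "ln (1 / D) \<le> 1 / D" using ln_le_minus_one[of "1 / D"] D by simp
    moreover have "1 / 2 \<le> ln (2 :: real)" using ln_le_minus_one[of "1 / 2 :: real"] by (simp add: ln_div)
    ultimately have "ln (1 / D) / ln 2 \<le> (1 / D) / (1 / 2)" using D by (intro frac_le) auto
    then show ?thesis by (simp add: log_def)
  qed
  then have "arg \<le> 24 * N * (2 / D) / (D^2 * \<eta> * \<delta>)"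
    unfolding arg_def using N D \<eta>0 \<delta> by (intro divide_right_mono mult_left_mono) auto
  also have "\<dots> = 1728 * 19^5 * (real nS ^ 2 * real nA ^ 3 * t^4 / (\<epsilon>^5 * \<delta>^2))"
    unfolding \<eta> \<zeta>D D_def N_def using \<epsilon> t \<delta> S1 by (simp add: field_simps power2_eq_square power3_eq_cube eval_nat_numeral)
  \<comment> \<open>All exponents are raised to 5 to form a power of \<open>x\<close>, and
    \<open>2^32\<close> is a power of two just above \<open>1728 * 19^5\<close>.\<close>
  also have "\<dots> \<le> 2^32 * x^5"
  proof (rule mult_mono)
    have "real nS ^ 2 * real nA ^ 3 * t^4 / (\<epsilon>^5 * \<delta>^2) \<le> real nS ^ 5 * real nA ^ 5 * t^5 / (\<epsilon>^5 * \<delta>^5)"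
      using S1 t \<epsilon> \<delta> by (intro frac_le mult_mono power_increasing power_decreasing) auto
    then show "real nS ^ 2 * real nA ^ 3 * t^4 / (\<epsilon>^5 * \<delta>^2) \<le> x^5"
      by (simp add: x_def N_def power_mult_distrib power_divide)
  qed (use t \<epsilon> \<delta> in auto)
  finally have "arg \<le> 2^32 * x^5" .
  then have "ln arg \<le> ln (2^32 * x^5)"
    using yarg y19 by (intro ln_mono) linarith+
  also have "\<dots> = 32 * ln 2 + 5 * ln x" using x1 ln_realpow[of "2 :: real" 32] by (simp add: ln_mult ln_realpow)
  also have "\<dots> \<le> 32 + 32 * ln x" using ln_le_minus_one[of "2 :: real"] ln_ge_zero[OF x1] by linarith
  finally show "\<beta> \<le> 64 * (1 + ln (real nS * real nA * t / (\<epsilon> * \<delta>)))"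
    unfolding \<beta> N_def[symmetric] x_def[symmetric] by simp
qed

theorem theorem2:
  fixes p :: "'s::finite \<Rightarrow> 'a::finite \<Rightarrow> 's pmf"
    and r :: "'s \<Rightarrow> 'a \<Rightarrow> real"
    and \<epsilon> \<delta> \<gamma> \<zeta> :: real and n :: nat
  assumes r_range: "\<forall>s a. 0 \<le> r s a \<and> r s a \<le> 1"
    and erg: "uniformly_ergodic p"
    and eps: "0 < \<epsilon>" "\<epsilon> \<le> 1"
    and del: "0 < \<delta>" "\<delta> < 1"
    and gamma_def: "\<gamma> = 1 - \<epsilon> / (19 * t_minorize p)"
    and zeta_def: "\<zeta> = (1 - \<gamma>) * t_minorize p / 4"
    and n_def: "n = nat \<lceil>(4 * 486^2) * beta_delta CARD('s) CARD('a) \<gamma> \<delta>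
                        (eta_star CARD('s) CARD('a) \<gamma> \<zeta> \<delta>)
                      / ((1 - \<gamma>)^2 * t_minorize p)\<rceil>"
  shows "measure (pmbp_space p \<zeta> n)
           {\<omega> \<in> space (pmbp_space p \<zeta> n). \<forall>pol. pmbp_output r \<gamma> n \<omega> pol \<longrightarrow>
              0 \<le> opt_avg_reward p r - avg_reward p r pol
              \<and> opt_avg_reward p r - avg_reward p r pol \<le> \<epsilon>} \<ge> 1 - \<delta>
       \<and> real (CARD('s) * CARD('a) * n)
           \<le> 10^11 * real (CARD('s) * CARD('a)) * t_minorize p / \<epsilon>^2
              * (1 + ln (real (CARD('s) * CARD('a)) * t_minorize p / (\<epsilon> * \<delta>)))"
proof -

  \<comment> \<open>Basic quantities and the sample size\<close>
  define t where "t = t_minorize p"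
  define D where "D = 1 - \<gamma>"
  define N where "N = real CARD('s) * real CARD('a)"
  define \<beta> where "\<beta> = beta_delta CARD('s) CARD('a) \<gamma> \<delta> (eta_star CARD('s) CARD('a) \<gamma> \<zeta> \<delta>)"
  define L where "L = ln (18 * N / (D^2 * \<delta>))"
  have t: "1 \<le> t" unfolding t_def by (rule t_minorize_ge_1[OF erg])
  have cards: "1 \<le> CARD('s)" "1 \<le> CARD('a)" by (simp_all add: Suc_le_eq card_gt_0_iff)
  then have N: "1 \<le> N" unfolding N_def using mult_mono[of 1 "real CARD('s)" 1 "real CARD('a)"] by simp
  have D_eq: "D = \<epsilon> / (19 * t)" by (simp add: D_def gamma_def t_def)
  have D: "0 < D" "D \<le> 1 / 19" unfolding D_eq using eps t by (auto simp: field_simps)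
  have Dt: "D * t = \<epsilon> / 19" unfolding D_eq using t by simp
  have \<gamma>: "0 \<le> \<gamma>" "\<gamma> < 1" using D by (auto simp: D_def)
  have \<zeta>: "\<zeta> = \<epsilon> / 76" by (simp add: zeta_def D_def[symmetric] t_def[symmetric] Dt)
  have \<beta>: "L \<le> \<beta>" "0 < \<beta>" "\<beta> \<le> 64 * (1 + ln (N * t / (\<epsilon> * \<delta>)))"
    using beta_delta_bounds[OF cards t eps del gamma_def[folded t_def] zeta_def[folded t_def]]
    by (simp_all add: L_def N_def D_def[symmetric] \<beta>_def)
  define y where "y = 944784 * \<beta> / (D^2 * t)"
  have y: "0 < y" unfolding y_def using \<beta> D t by simp
  have "n = nat \<lceil>y\<rceil>" by (simp add: n_def y_def \<beta>_def D_def t_def)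
  then have n: "y \<le> real n" "real n \<le> y + 1" "0 < n" using y by linarith+

  \<comment> \<open>Net, failure probability and error budget\<close>
  define \<mu> where "\<mu> = D / 1000"
  \<comment> \<open>The net covers \<open>[0, 2 / D]\<close>, the range of values for rewards up to
    2; \<open>8 / D^2\<close> points make its mesh at most \<open>D / 4\<close>.\<close>
  define J where "J = nat \<lceil>8 / D^2\<rceil>"
  define \<eta> where "\<eta> = 2 / D / real J"
  define l where "l = L / (real n * \<mu>)"
  \<comment> \<open>The net transfer doubles \<mu>, so \<open>D / 1000\<close> produces the variance
    coefficient \<open>(1 - \<gamma>) / 500\<close> needed later.\<close>
  have \<mu>: "0 < \<mu>" "\<mu> * (2 / (1 - \<gamma>)) \<le> 1" using D by (auto simp: \<mu>_def D_def[symmetric])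
  have D2: "361 \<le> 1 / D^2"
  proof -
    have "D^2 \<le> (1 / 19)^2" using D by (intro power_mono) auto
    then show ?thesis using D by (simp add: field_simps power2_eq_square)
  qed
  have J: "8 / D^2 \<le> real J" "real J + 1 \<le> 9 * (1 / D^2)" "0 < real J"
  proof -
    have "0 < 8 / D^2" using D by simp
    then show "8 / D^2 \<le> real J" "0 < real J" unfolding J_def by linarith+
    have "real J \<le> 8 / D^2 + 1" using \<open>0 < 8 / D^2\<close> unfolding J_def by linarith
    then show "real J + 1 \<le> 9 * (1 / D^2)" using D2 by simp
  qed
  have \<eta>: "0 < \<eta>" "real J * \<eta> = 2 / (1 - \<gamma>)" "\<eta> \<le> D / 4"
  proof -
    show "0 < \<eta>" "real J * \<eta> = 2 / (1 - \<gamma>)" using D J by (auto simp: \<eta>_def D_def[symmetric])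
    have "2 / D / real J \<le> 2 / D / (8 / D^2)"
      using D J by (intro divide_left_mono) auto
    also have "\<dots> = D / 4" using D by (simp add: field_simps power2_eq_square)
    finally show "\<eta> \<le> D / 4" by (simp add: \<eta>_def)
  qed
  \<comment> \<open>The 18 in \<open>L\<close> is the factor 2 of the two-sided bound times the 9 in
    \<open>J + 1 \<le> 9 / D^2\<close>.\<close>
  have failure: "real (CARD('s) * CARD('a) * (J + 1)) * (2 * exp (- L)) \<le> \<delta>"
  proof -
    have "exp (- L) = D^2 * \<delta> / (18 * N)"
      using N D del by (simp add: L_def exp_minus)
    then have "real (CARD('s) * CARD('a) * (J + 1)) * (2 * exp (- L)) = (real J + 1) * (D^2 * \<delta> / 9)"
      using N by (simp add: N_def field_simps)
    also have "\<dots> \<le> 9 * (1 / D^2) * (D^2 * \<delta> / 9)"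
      using J D del by (intro mult_right_mono) auto
    also have "\<dots> = \<delta>" using D by simp
    finally show ?thesis .
  qed
  have l: "l \<le> D * t / 900"
  proof -
    have "y * \<mu> \<le> real n * \<mu>" using n \<mu> by (intro mult_right_mono) auto
    then have "L / (real n * \<mu>) \<le> \<beta> / (y * \<mu>)"
      using \<beta> y \<mu> by (intro frac_le) auto
    also have "\<dots> = 1000 / 944784 * (D * t)"
      unfolding y_def \<mu>_def using \<beta> D t by (simp add: field_simps power2_eq_square)
    also have "\<dots> \<le> D * t / 900" using D t by simp
    finally show ?thesis by (simp add: l_def)
  qed
  \<comment> \<open>The mesh term, at most \<open>D / 2\<close>, dominates; the others add less than
    \<open>D * t / 10\<close>.\<close>
  have l': "l + 2 * \<eta> + 2 * \<mu> * \<eta>^2 \<le> 3 / 5 * (1 - \<gamma>) * t_minorize p"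
  proof -
    have "\<mu> * \<eta>^2 \<le> D / 1000 * 1"
      unfolding \<mu>_def using D \<eta> by (intro mult_mono power_le_one) auto
    moreover have "D \<le> D * t" using D t by simp
    ultimately have "l + 2 * \<eta> + 2 * \<mu> * \<eta>^2 \<le> 3 / 5 * (D * t)" using l \<eta>(3) D(1) by (simp only: mult.assoc)
    then show ?thesis unfolding D_def t_def by (simp only: mult.assoc)
  qed

  \<comment> \<open>Deterministic guarantee on the concentration event\<close>
  let ?M = "pmbp_space p \<zeta> n"
  let ?ok = "\<lambda>pol. 0 \<le> opt_avg_reward p r - avg_reward p r pol
      \<and> opt_avg_reward p r - avg_reward p r pol \<le> \<epsilon>"
  let ?G = "{\<omega> \<in> space ?M. \<forall>pol. pmbp_output r \<gamma> n \<omega> pol \<longrightarrow> ?ok pol}"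
  have ok: "?ok pol"
    if Z: "\<And>k. 0 < Z k \<and> Z k < \<zeta>"
      and X: "\<forall>s a. \<forall>j\<le>J. \<bar>(\<Sum>s'\<in>UNIV. phat n X s a s' * absorb_value (\<lambda>s a. r s a + Z (s, a)) (phat n X) \<gamma> s (real j * \<eta>) s')
             - pmean (p s a) (absorb_value (\<lambda>s a. r s a + Z (s, a)) (phat n X) \<gamma> s (real j * \<eta>))\<bar>
          \<le> \<mu> * pvar (p s a) (absorb_value (\<lambda>s a. r s a + Z (s, a)) (phat n X) \<gamma> s (real j * \<eta>)) + l"
      and out: "greedy (\<lambda>s a. r s a + Z (s, a)) (phat n X) \<gamma> pol" for Z X pol
  proof -
    let ?R = "\<lambda>s a. r s a + Z (s, a)"
    have R: "r s a \<le> ?R s a" "?R s a \<le> r s a + \<zeta>" "0 \<le> ?R s a" "?R s a \<le> 2" for s a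
    proof -
      have "0 < Z (s, a)" "Z (s, a) < \<zeta>" "\<zeta> \<le> 1" using Z[of "(s, a)"] eps by (auto simp: \<zeta>)
      moreover have "0 \<le> r s a" "r s a \<le> 1" using r_range by auto
      ultimately show "r s a \<le> ?R s a" "?R s a \<le> r s a + \<zeta>" "0 \<le> ?R s a" "?R s a \<le> 2" by linarith+
    qed
    have ph: "stochastic (phat n X)" by (rule stochastic_phat[OF n(3)])
    have err: "\<bar>(\<Sum>s'\<in>UNIV. phat n X s a s' * disc_value ?R (phat n X) \<gamma> s')
          - pmean (p s a) (disc_value ?R (phat n X) \<gamma>)\<bar>
        \<le> (1 - \<gamma>) / 500 * pvar (p s a) (disc_value ?R (phat n X) \<gamma>) + (l + 2 * \<eta> + 2 * \<mu> * \<eta>^2)" for s a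
    proof -
      have rng: "0 \<le> disc_value ?R (phat n X) \<gamma> s \<and> disc_value ?R (phat n X) \<gamma> s \<le> 2 / (1 - \<gamma>)"
        by (rule disc_value_range[OF ph \<gamma> R(3,4)])
      have "\<bar>(\<Sum>s'\<in>UNIV. phat n X s a s' * disc_value ?R (phat n X) \<gamma> s')
          - pmean (p s a) (disc_value ?R (phat n X) \<gamma>)\<bar>
        \<le> 2 * \<mu> * pvar (p s a) (disc_value ?R (phat n X) \<gamma>) + (l + 2 * \<eta> + 2 * \<mu> * \<eta>^2)"
        by (rule net_concentration_transfer[OF ph \<gamma> \<eta>(1), where J=J])
           (use \<mu> rng \<eta>(2) X in auto)
      also have "2 * \<mu> * pvar (p s a) (disc_value ?R (phat n X) \<gamma>)
          = (1 - \<gamma>) / 500 * pvar (p s a) (disc_value ?R (phat n X) \<gamma>)"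
        by (simp add: \<mu>_def D_def)
      finally show ?thesis .
    qed
    have r: "0 \<le> r s a" "r s a \<le> 1" for s a using r_range by auto
    have \<zeta>1: "\<zeta> \<le> 1" using eps by (simp add: \<zeta>)
    \<comment> \<open>With \<open>D * t = \<epsilon> / 19\<close> and
      \<open>\<zeta> = \<epsilon> / 76\<close> the sum is
      \<open>21 / 76 * \<epsilon>\<close>.\<close>
    have "5 * (1 - \<gamma>) * t_minorize p + \<zeta> = 5 * (D * t) + \<zeta>" by (simp add: D_def t_def)
    also have "\<dots> \<le> \<epsilon>" unfolding Dt \<zeta> using eps by simp
    finally show ?thesis
      using greedy_policy_average_gap[where R="?R" and r=r, OF erg \<gamma> ph r R(1,2) \<zeta>1 err l' out] by auto
  qed

  \<comment> \<open>Probability of success\<close>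
  have "1 - \<delta> \<le> measure ?M ?G"
  proof (rule pmbp_space_prob_ge)
    \<comment> \<open>Whether a policy is good does not depend on the randomness, so failure is a
      finite union of output events over the bad policies.\<close>
    have "?G = space ?M - (\<Union>pol\<in>{pol. \<not> ?ok pol}. {\<omega> \<in> space ?M. pmbp_output r \<gamma> n \<omega> pol})"
      by auto
    also have "\<dots> \<in> sets ?M"
      by (intro sets.Diff sets.top sets.finite_UN pmbp_output_measurable n \<gamma>) auto
    finally show "?G \<in> sets ?M" .
    show "0 < \<zeta>" "0 \<le> 1 - \<delta>" using eps del by (auto simp: \<zeta>)
    fix Z :: "'s \<times> 'a \<Rightarrow> real" assume Z: "\<And>k. 0 < Z k \<and> Z k < \<zeta>"
    let ?R = "\<lambda>s a. r s a + Z (s, a)"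
    let ?X = "{X. \<forall>s a. \<forall>j\<le>J. \<bar>(\<Sum>s'\<in>UNIV. phat n X s a s' * absorb_value ?R (phat n X) \<gamma> s (real j * \<eta>) s')
             - pmean (p s a) (absorb_value ?R (phat n X) \<gamma> s (real j * \<eta>))\<bar>
          \<le> \<mu> * pvar (p s a) (absorb_value ?R (phat n X) \<gamma> s (real j * \<eta>)) + l}"
    have R: "0 \<le> ?R s a" "?R s a \<le> 2" for s a
    proof -
      have "0 < Z (s, a)" "Z (s, a) < \<zeta>" "\<zeta> \<le> 1" using Z[of "(s, a)"] eps by (auto simp: \<zeta>)
      moreover have "0 \<le> r s a" "r s a \<le> 1" using r_range by auto
      ultimately show "0 \<le> ?R s a" "?R s a \<le> 2" by linarith+
    qed
    have "1 - \<delta> \<le> 1 - real (CARD('s) * CARD('a) * (J + 1)) * (2 * exp (- L))"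
      using failure by linarith
    also have "\<dots> \<le> measure_pmf.prob (sample_pmf p n) ?X"
      unfolding l_def by (rule net_concentration[OF n(3) \<gamma> R _ _ \<mu>]) (use \<eta> in auto)
    also have "\<dots> \<le> measure_pmf.prob (sample_pmf p n) (Pair Z -` ?G)"
    proof (rule measure_pmf.finite_measure_mono)
      have "(Z, X) \<in> space ?M" for X
        by (simp add: pmbp_space_def space_pair_measure space_PiM)
      then show "?X \<subseteq> Pair Z -` ?G"
        using ok[OF Z] by (auto simp: pmbp_output_def)
    qed simp
    finally show "1 - \<delta> \<le> measure_pmf.prob (sample_pmf p n) (Pair Z -` ?G)" .
  qed

  \<comment> \<open>Total number of samples\<close>
  moreover have "real (CARD('s) * CARD('a) * n)
      \<le> 10^11 * N * t / \<epsilon>^2 * (1 + ln (N * t / (\<epsilon> * \<delta>)))"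
  proof -
    define K where "K = 1 + ln (N * t / (\<epsilon> * \<delta>))"
    have "1 \<le> N * t / (\<epsilon> * \<delta>)"
    proof -
      have "\<epsilon> * \<delta> \<le> 1 * 1" using eps del by (intro mult_mono) auto
      moreover have "1 * 1 \<le> N * t" using N t by (intro mult_mono) auto
      ultimately show ?thesis using eps del by (simp add: pos_le_divide_eq)
    qed
    then have K: "1 \<le> K" by (simp add: K_def)
    define W where "W = t / \<epsilon>^2 * K"
    have t\<epsilon>: "1 \<le> t / \<epsilon>^2" using t eps power_le_one[of \<epsilon> 2] by (simp add: pos_le_divide_eq)
    have "y = 944784 * 361 * (t / \<epsilon>^2) * \<beta>"
      unfolding y_def D_eq using t eps by (simp add: field_simps power2_eq_square)
    also have "\<dots> \<le> 944784 * 361 * (t / \<epsilon>^2) * (64 * K)"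
      using \<beta>(3) t\<epsilon> unfolding K_def[symmetric] by (intro mult_left_mono) auto
    finally have "y \<le> 21828289536 * W" by (simp add: W_def)
    moreover have "1 \<le> W" unfolding W_def using mult_mono[OF t\<epsilon> K] t\<epsilon> by simp
    \<comment> \<open>The coefficient is \<open>944784 * 19^2 * 64\<close>, with
      \<open>944784 = 4 * 486^2\<close>; the slack up to \<open>10^11\<close> also absorbs the 1
      from rounding up, because \<open>1 \<le> W\<close>.\<close>
    ultimately have "real n \<le> 10^11 * W" using n(2) by simp
    then have "N * real n \<le> N * (10^11 * W)" using N by (intro mult_left_mono) auto
    then show ?thesis unfolding K_def[symmetric] by (simp add: N_def W_def mult_ac)
  qed
  ultimately show ?thesis by (simp add: N_def t_def)
qed

end
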